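(* Suppose that the triangular array $\{x_{i,n}\}_{1\le i\le n}$ satisfies the UPDC condition and the short-range dependence condition with exponent $\tau>1$ (both defined in the context). Then for all $1\le i\le n$, $$x_{i,n}=\phi_{i0,n}+\sum_{j=1}^{\min\{b,i-1\}}\phi_{ij,n}x_{i-j,n}+\epsilon_{i,n}+O_{\ell^2}\Big((\log b)^{\tau-1}b^{-(\tau-1.5)}\Big).$$ Furthermore, for all $1\le i\le n$, $$x_{i,n}-x_{i,n}^*=O_{\ell^2}\Big((\log b)^{\tau-1}b^{-(\tau-1.5)}\Big),$$ where $\{x^*_{i,n}\}$ is the time-varying AR($b$) process defined by $x^*_{i,n}=x_{i,n}$ for $i\le b$ and $$x^*_{i,n}=\phi_{i0,n}+\sum_{j=1}^b\phi_{ij,n}x^*_{i-j,n}+\epsilon_{i,n}\qquad (i>b).$$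
   Context: For each $n$, $x_{1,n},\dots,x_{n,n}$ are real random variables. Constants do not depend on $n$. $y=O_{\ell^2}(a_n)$ means $(\mathbb{E}|y|^2)^{1/2}\le C a_n$ for a finite constant $C$ (not depending on $i$ and $n$). UPDC condition: there is a universal constant $\kappa>0$ such that for all sufficiently large $n$ the smallest eigenvalue of the covariance matrix $\operatorname{Cov}(x_{1,n},\dots,x_{n,n})$ is at least $\kappa$. Short-range dependence condition with exponent $\tau>1$: there is a constant $C>0$ independent of $n$ with $|\operatorname{Cov}(x_{k,n},x_{k+r,n})|\le C|r|^{-\tau}$ for all $n$, $1\le k\le n$, $-k+1\le r\le n-k$, $r\ne0$; also $\sup_{i,n}\operatorname{Var}(x_{i,n})<\infty$ and $\sup_{i,n}\mathbb{E}|x_{i,n}|<\infty$. The best linear prediction (in mean squared error, with intercept) of $x_{i,n}$ from all its predecessors $x_{i-1,n},\dots,x_{1,n}$ is $\widehat x_{i,n}=\phi_{i0,n}+\sum_{j=1}^{i-1}\phi_{ij,n}x_{i-j,n}$; this defines $\phi_{ij,n}$. The prediction error is $\epsilon_{i,n}=x_{i,n}-\widehat x_{i,n}$, a time-varying white noise (mean zero, uncorrelated). The order $b=b(n)$ is a sequence of positive integers, $b<n$, diverging to infinity with $n$.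
   Formalization: The bounds are stated for all rows n with b(n) ≥ 2 (all but finitely many, since b diverges): when b = 1 the factor (log b)^{τ-1} is 0 and the claimed bound would force the remainder to vanish, which is false in general. *)

theory Defs
  imports
    "HOL-Probability.Probability"
    "Jordan_Normal_Form.Spectral_Radius"
begin

text \<open>
  Triangular arrays: row \<open>n\<close> lives on its own probability space \<open>M n\<close>, and \<open>x n i\<close> with
  \<open>1 \<le> i \<le> n\<close> is its \<open>i\<close>-th entry. Values of \<open>x n i\<close> for other \<open>i\<close> are irrelevant.
\<close>

definition square_integrable :: "'a measure \<Rightarrow> ('a \<Rightarrow> real) \<Rightarrow> bool" where
  "square_integrable M X \<longleftrightarrow> X \<in> borel_measurable M \<and> integrable M (\<lambda>\<omega>. (X \<omega>)\<^sup>2)"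

text \<open>Square integrability makes all (co)variances below genuine: a Bochner integral that does
  not exist would be \<open>0\<close>.\<close>

definition triangular_array ::
  "(nat \<Rightarrow> 'a measure) \<Rightarrow> (nat \<Rightarrow> nat \<Rightarrow> 'a \<Rightarrow> real) \<Rightarrow> bool" where
  "triangular_array M x \<longleftrightarrow>
     (\<forall>n. prob_space (M n) \<and> (\<forall>i\<in>{1..n}. square_integrable (M n) (x n i)))"

definition covariance :: "'a measure \<Rightarrow> ('a \<Rightarrow> real) \<Rightarrow> ('a \<Rightarrow> real) \<Rightarrow> real" where
  "covariance M X Y = (\<integral>\<omega>. (X \<omega> - (\<integral>\<omega>. X \<omega> \<partial>M)) * (Y \<omega> - (\<integral>\<omega>. Y \<omega> \<partial>M)) \<partial>M)"

text \<open>Matrix indices start at \<open>0\<close>, the array index at \<open>1\<close>.\<close>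

definition cov_matrix :: "'a measure \<Rightarrow> nat \<Rightarrow> (nat \<Rightarrow> 'a \<Rightarrow> real) \<Rightarrow> real mat" where
  "cov_matrix M n X = mat n n (\<lambda>(i, j). covariance M (X (Suc i)) (X (Suc j)))"

text \<open>Used only for symmetric real matrices of positive size, whose real spectrum is finite and
  nonempty.\<close>

definition smallest_eigenvalue :: "real mat \<Rightarrow> real" where
  "smallest_eigenvalue A = Min (spectrum A)"

definition UPDC :: "(nat \<Rightarrow> 'a measure) \<Rightarrow> (nat \<Rightarrow> nat \<Rightarrow> 'a \<Rightarrow> real) \<Rightarrow> bool" where
  "UPDC M x \<longleftrightarrow>
     (\<exists>\<kappa>>0. \<forall>\<^sub>F n in sequentially. \<kappa> \<le> smallest_eigenvalue (cov_matrix (M n) n (x n)))"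

definition short_range_dependent ::
  "real \<Rightarrow> (nat \<Rightarrow> 'a measure) \<Rightarrow> (nat \<Rightarrow> nat \<Rightarrow> 'a \<Rightarrow> real) \<Rightarrow> bool" where
  "short_range_dependent \<tau> M x \<longleftrightarrow>
     (\<exists>C>0. \<forall>n. \<forall>k\<in>{1..n}. \<forall>r\<in>{- int k + 1..int n - int k}. r \<noteq> 0 \<longrightarrow>
        \<bar>covariance (M n) (x n k) (x n (nat (int k + r)))\<bar> \<le> C * real_of_int \<bar>r\<bar> powr (- \<tau>)) \<and>
     (\<exists>B. \<forall>n. \<forall>i\<in>{1..n}. prob_space.variance (M n) (x n i) \<le> B) \<and>
     (\<exists>B. \<forall>n. \<forall>i\<in>{1..n}. prob_space.expectation (M n) (\<lambda>\<omega>. \<bar>x n i \<omega>\<bar>) \<le> B)"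

definition linear_pred ::
  "nat \<Rightarrow> (nat \<Rightarrow> real) \<Rightarrow> (nat \<Rightarrow> 'a \<Rightarrow> real) \<Rightarrow> nat \<Rightarrow> 'a \<Rightarrow> real" where
  "linear_pred m c X i \<omega> = c 0 + (\<Sum>j = 1..m. c j * X (i - j) \<omega>)"

text \<open>A relation rather than a function, because the minimiser need not be unique when the
  covariance matrix is singular, which UPDC allows for finitely many \<open>n\<close>. Coefficients \<open>c j\<close> with
  \<open>j \<ge> i\<close> are unconstrained.\<close>

definition best_linear_pred_coeffs ::
  "'a measure \<Rightarrow> (nat \<Rightarrow> 'a \<Rightarrow> real) \<Rightarrow> nat \<Rightarrow> (nat \<Rightarrow> real) \<Rightarrow> bool" where
  "best_linear_pred_coeffs M X i c \<longleftrightarrow>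
     (\<forall>d. (\<integral>\<omega>. (X i \<omega> - linear_pred (i - 1) c X i \<omega>)\<^sup>2 \<partial>M)
        \<le> (\<integral>\<omega>. (X i \<omega> - linear_pred (i - 1) d X i \<omega>)\<^sup>2 \<partial>M))"

definition prediction_error ::
  "(nat \<Rightarrow> nat \<Rightarrow> real) \<Rightarrow> (nat \<Rightarrow> 'a \<Rightarrow> real) \<Rightarrow> nat \<Rightarrow> 'a \<Rightarrow> real" where
  "prediction_error \<phi> X i \<omega> = X i \<omega> - linear_pred (i - 1) (\<phi> i) X i \<omega>"

fun ar_process ::
  "nat \<Rightarrow> (nat \<Rightarrow> nat \<Rightarrow> real) \<Rightarrow> (nat \<Rightarrow> 'a \<Rightarrow> real) \<Rightarrow> nat \<Rightarrow> 'a \<Rightarrow> real" where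
  "ar_process b \<phi> X i \<omega> =
     (if i \<le> b then X i \<omega>
      else \<phi> i 0 + (\<Sum>j = 1..b. \<phi> i j * ar_process b \<phi> X (i - j) \<omega>) + prediction_error \<phi> X i \<omega>)"

declare ar_process.simps [simp del]

text \<open>\<open>y\<^sub>i\<^sub>,\<^sub>n = O\<^bsub>\<ell>\<^sup>2\<^esub>(a\<^sub>n)\<close> with one constant for all rows \<open>n \<in> N\<close> and all \<open>1 \<le> i \<le> n\<close>.\<close>

definition O_l2 ::
  "nat set \<Rightarrow> (nat \<Rightarrow> 'a measure) \<Rightarrow> (nat \<Rightarrow> nat \<Rightarrow> 'a \<Rightarrow> real) \<Rightarrow> (nat \<Rightarrow> real) \<Rightarrow> bool" where
  "O_l2 N M y a \<longleftrightarrow>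
     (\<exists>C. \<forall>n\<in>N. \<forall>i\<in>{1..n}.
        square_integrable (M n) (y n i) \<and> sqrt (\<integral>\<omega>. \<bar>y n i \<omega>\<bar>\<^sup>2 \<partial>M n) \<le> C * a n)"

text \<open>For \<open>b = 1\<close> the factor \<open>ln b\<close> vanishes and the rate is \<open>0\<close>, so bounds at this rate are only
  meaningful for rows with \<open>b \<ge> 2\<close>.\<close>

definition ar_rate :: "real \<Rightarrow> nat \<Rightarrow> real" where
  "ar_rate \<tau> b = ln (real b) powr (\<tau> - 1) * real b powr (- (\<tau> - 1.5))"

end

theory Submission
  imports Defs "HOL-Real_Asymp.Real_Asymp"
begin

text \<open>
  With \<open>f\<^sub>0 = -1\<close> and \<open>f\<^sub>j = \<phi>\<^sub>i\<^sub>j\<close>, the normal equations say that the covariance form applied to \<open>f\<close>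
  vanishes at every lag \<open>\<ge> 1\<close>. Testing them with the tail of \<open>f\<close> and using coercivity gives a
  hole-filling inequality for the tail energies, which yields
  \<open>\<Sum>\<^sub>j\<^sub>>\<^sub>s \<bar>\<phi>\<^sub>i\<^sub>j\<bar> \<le> A s\<^sup>-\<^sup>\<beta>\<close> uniformly in \<open>i\<close> and \<open>n\<close>, for every \<open>\<beta> < \<tau> - 1\<close>. The truncation
  error is therefore of this order in \<open>\<ell>\<^sup>2\<close>; the square-summable tail alone would not control the
  contribution of the means.
  For the second claim, the error \<open>d = x - x\<^sup>*\<close> solves \<open>d\<^sub>i - \<Sum>\<^sub>k \<phi>\<^sub>i\<^sub>k d\<^sub>i\<^sub>-\<^sub>k = w\<^sub>i\<close> where \<open>w\<close> involves
  only the lags \<open>> b\<close> of \<open>x\<^sup>*\<close>. The inverse of this triangular system has the entries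
  \<open>Cov(x\<^sub>i, \<epsilon>\<^sub>j) / Var(\<epsilon>\<^sub>j)\<close>, whose absolute row sums are bounded, so \<open>d\<close> is controlled by \<open>w\<close> and the
  part of \<open>w\<close> depending on \<open>d\<close> can be absorbed.
\<close>

subsection \<open>Power sums\<close>

text \<open>Peel off the block from \<open>s\<close> to \<open>2 * s\<close>; the rest starts at
  \<open>2 * s\<close>, where the claimed bound is smaller by the factor
  \<open>q = 2 powr (- \<beta>)\<close>. The constant is the geometric series over the blocks,
  \<open>B + B / (1 - q) * q = B / (1 - q)\<close>.\<close>

lemma dyadic_tail:
  fixes h :: "nat \<Rightarrow> real"
  assumes "\<beta> > 0" "B \<ge> 0"
    and block: "\<And>s. 1 \<le> s \<Longrightarrow> (\<Sum>j\<in>{s<..min (2 * s) N}. h j) \<le> B * real s powr (- \<beta>)"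
    and "1 \<le> s"
  shows "(\<Sum>j\<in>{s<..N}. h j) \<le> B / (1 - 2 powr (- \<beta>)) * real s powr (- \<beta>)"
  using \<open>1 \<le> s\<close>
proof (induction "N - s" arbitrary: s rule: less_induct)
  case less
  have q: "2 powr (- \<beta>) < 1" using \<open>\<beta> > 0\<close> by (simp add: powr_minus_divide)
  show ?case
  proof (cases "s < N")
    case False
    then show ?thesis using assms q by simp
  next
    case True
    have split: "{s<..N} = {s<..min (2 * s) N} \<union> {2 * s<..N}" using less.prems by auto
    have "(\<Sum>j\<in>{s<..N}. h j) = (\<Sum>j\<in>{s<..min (2 * s) N}. h j) + (\<Sum>j\<in>{2 * s<..N}. h j)"
      unfolding split by (rule sum.union_disjoint) auto
    also have "(\<Sum>j\<in>{2 * s<..N}. h j) \<le> B / (1 - 2 powr (- \<beta>)) * real (2 * s) powr (- \<beta>)"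
      using less.prems True by (intro less.hyps) auto
    also have "real (2 * s) powr (- \<beta>) = 2 powr (- \<beta>) * real s powr (- \<beta>)"
      by (simp add: powr_mult)
    finally have "(\<Sum>j\<in>{s<..N}. h j) \<le>
        (B + B / (1 - 2 powr (- \<beta>)) * 2 powr (- \<beta>)) * real s powr (- \<beta>)"
      using block[OF less.prems] by (simp add: algebra_simps)
    also have "B + B / (1 - 2 powr (- \<beta>)) * 2 powr (- \<beta>) = B / (1 - 2 powr (- \<beta>))"
    proof -
      define z where "z = 2 powr (- \<beta>)"
      show ?thesis using q unfolding z_def[symmetric] by (simp add: field_simps)
    qed
    finally show ?thesis .
  qed
qed

text \<open>A dyadic block starting at \<open>s\<close> has at most \<open>s\<close> terms, each at
  most \<open>s powr (- p)\<close>, so \<open>dyadic_tail\<close> applies with exponent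
  \<open>p - 1\<close>.\<close>

lemma powr_sum_tail:
  assumes "p > 1" "1 \<le> m"
  shows "(\<Sum>r\<in>{m<..N}. real r powr (- p)) \<le> 1 / (1 - 2 powr (1 - p)) * real m powr (1 - p)"
proof -
  have "(\<Sum>r\<in>{s<..min (2 * s) N}. real r powr (- p)) \<le> 1 * real s powr (- (p - 1))" if "1 \<le> s" for s
  proof -
    have "(\<Sum>r\<in>{s<..min (2 * s) N}. real r powr (- p)) \<le> (\<Sum>r\<in>{s<..min (2 * s) N}. real s powr (- p))"
      using assms that by (intro sum_mono powr_mono2') auto
    also have "\<dots> = real (min (2 * s) N - s) * real s powr (- p)" by simp
    also have "\<dots> \<le> real s * real s powr (- p)"
      by (intro mult_right_mono) auto
    also have "\<dots> = real s powr (- (p - 1))"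
      using that by (simp add: powr_mult_base)
    finally show ?thesis by simp
  qed
  from dyadic_tail[OF _ _ this, of m] assms show ?thesis by simp
qed

text \<open>Twice a bound for the one-sided sum of \<open>r powr (- \<tau>)\<close>: the inner
  \<open>1\<close> is the term \<open>r = 1\<close>, the fraction is the tail bound beyond
  it.\<close>

definition kernel_sum :: "real \<Rightarrow> real" where
  "kernel_sum \<tau> = 2 * (1 + 1 / (1 - 2 powr (1 - \<tau>)))"

lemma kernel_sum_pos: "\<tau> > 1 \<Longrightarrow> kernel_sum \<tau> > 0"
proof -
  assume "\<tau> > 1"
  then have "2 powr (1 - \<tau>) < (2::real) powr 0" by (intro powr_less_mono) auto
  then show ?thesis unfolding kernel_sum_def by (intro mult_pos_pos add_pos_pos) auto
qed

lemma powr_sum_le: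
  assumes "\<tau> > 1"
  shows "(\<Sum>r\<in>{0<..N}. real r powr (- \<tau>)) \<le> kernel_sum \<tau> / 2"
proof (cases "N = 0")
  case True
  then show ?thesis using kernel_sum_pos[OF assms] by simp
next
  case False
  then have "{0<..N} = insert 1 {1<..N}" by auto
  then show ?thesis using powr_sum_tail[OF assms, of 1 N] by (simp add: kernel_sum_def)
qed

lemma kernel_row_sum:
  assumes "\<tau> > 1" and "J \<subseteq> {..N}" "l \<le> N"
  shows "(\<Sum>j\<in>J. (1 + \<bar>real l - real j\<bar>) powr (- \<tau>)) \<le> kernel_sum \<tau>"
proof -
  let ?w = "\<lambda>j. (1 + \<bar>real l - real j\<bar>) powr (- \<tau>)"
  have "(\<Sum>j\<in>J. ?w j) \<le> (\<Sum>j\<in>{..l} \<union> {l<..N}. ?w j)"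
    using assms by (intro sum_mono2) auto
  also have "\<dots> = (\<Sum>j\<in>{..l}. ?w j) + (\<Sum>j\<in>{l<..N}. ?w j)"
    by (rule sum.union_disjoint) auto
  \<comment> \<open>The shift by one in the kernel puts the diagonal at \<open>r = 1\<close>, so it
    is counted on this side; the other side starts at \<open>r = 2\<close>.\<close>
  also have "(\<Sum>j\<in>{..l}. ?w j) = (\<Sum>r\<in>{0<..Suc l}. real r powr (- \<tau>))"
    by (rule sum.reindex_bij_witness[of _ "\<lambda>r. Suc l - r" "\<lambda>j. Suc l - j"])
      (auto simp: of_nat_diff algebra_simps)
  also have "\<dots> \<le> kernel_sum \<tau> / 2" by (rule powr_sum_le[OF assms(1)])
  also have "(\<Sum>j\<in>{l<..N}. ?w j) = (\<Sum>r\<in>{1<..Suc N - l}. real r powr (- \<tau>))"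
    by (rule sum.reindex_bij_witness[of _ "\<lambda>r. r + l - 1" "\<lambda>j. Suc j - l"])
      (auto simp: of_nat_diff algebra_simps)
  also have "\<dots> \<le> (\<Sum>r\<in>{0<..Suc N - l}. real r powr (- \<tau>))"
    by (intro sum_mono2) auto
  also have "\<dots> \<le> kernel_sum \<tau> / 2" by (rule powr_sum_le[OF assms(1)])
  finally show ?thesis by simp
qed

text \<open>Balances number against length of steps when a distance \<open>s\<close> is covered by
  \<open>k\<close> steps of length \<open>m\<close>. With \<open>k\<close> about
  \<open>s powr \<eta>\<close> the geometric term decays like a stretched exponential, so only the
  power of \<open>m\<close>, about \<open>s powr (1 - \<eta>)\<close>, determines the rate.\<close>

lemma geometric_plus_power_le:
  fixes \<theta> \<tau> \<beta> c :: real
  assumes "0 < \<theta>" "\<theta> < 1" "0 < \<beta>" "\<beta> < \<tau> - 1" "c \<ge> 0"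
  shows "\<exists>c'\<ge>0. \<forall>s\<ge>1. \<exists>k m. 1 \<le> m \<and> k * m \<le> s \<and>
     \<theta> ^ k + c * real m powr (1 - 2 * \<tau>) \<le> c' * real s powr (- (1 + 2 * \<beta>))"
proof -
  \<comment> \<open>Chosen so that \<open>(1 - \<eta>) * (2 * \<tau> - 1) = 1 + 2 * \<beta>\<close>;
    it is positive because \<open>\<beta> < \<tau> - 1\<close>.\<close>
  define \<eta> where "\<eta> = 1 - (1 + 2 * \<beta>) / (2 * \<tau> - 1)"
  have \<eta>: "0 < \<eta>" "\<eta> < 1" using assms by (auto simp: \<eta>_def field_simps)
  have \<eta>': "(1 - \<eta>) * (2 * \<tau> - 1) = 1 + 2 * \<beta>" using assms by (simp add: \<eta>_def field_simps)
  have "(\<lambda>s::nat. \<theta> powr (real s powr \<eta>) * real s powr (1 + 2 * \<beta>)) \<longlonglongrightarrow> 0"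
    using assms \<eta> by real_asymp
  then have "Bseq (\<lambda>s::nat. \<theta> powr (real s powr \<eta>) * real s powr (1 + 2 * \<beta>))"
    by (intro convergent_imp_Bseq) (auto simp: convergent_def)
  then obtain B where B: "B > 0" "\<And>s::nat. norm (\<theta> powr (real s powr \<eta>) * real s powr (1 + 2 * \<beta>)) \<le> B"
    by (auto simp: Bseq_def)
  \<comment> \<open>The factor \<open>1 / \<theta>\<close> pays for rounding \<open>k\<close> down,
    and \<open>2 powr (2 * \<tau> - 1)\<close> for rounding \<open>m\<close> down, which loses at
    most a factor two since \<open>m\<close> is at least one.\<close>
  define c' where "c' = B / \<theta> + c * 2 powr (2 * \<tau> - 1)"
  show ?thesis
  proof (intro exI[of _ c'] conjI allI impI)
    show "c' \<ge> 0" using B assms by (simp add: c'_def)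
    fix s :: nat assume s: "1 \<le> s"
    define k where "k = nat \<lfloor>real s powr \<eta>\<rfloor>"
    define m where "m = nat \<lfloor>real s powr (1 - \<eta>)\<rfloor>"
    have s1: "real s powr (1 - \<eta>) \<ge> 1" using s \<eta> by (simp add: ge_one_powr_ge_zero)
    have k: "real k \<le> real s powr \<eta>" "real s powr \<eta> - 1 \<le> real k"
      unfolding k_def by (auto simp: of_nat_nat)
    have m: "real m \<le> real s powr (1 - \<eta>)" "real s powr (1 - \<eta>) - 1 \<le> real m" "1 \<le> m"
      unfolding m_def using s1 by (auto simp: of_nat_nat le_nat_floor)
    have m2: "real s powr (1 - \<eta>) / 2 \<le> real m" using m by linarith
    have "real (k * m) \<le> real s powr \<eta> * real s powr (1 - \<eta>)"
      using k m by (auto intro!: mult_mono)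
    also have "\<dots> = real s" using s by (simp add: powr_add[symmetric])
    finally have km: "k * m \<le> s" by linarith
    have "\<theta> ^ k = \<theta> powr real k" using assms by (simp add: powr_realpow)
    also have "\<dots> \<le> \<theta> powr (real s powr \<eta> - 1)"
      using k assms by (intro powr_mono') auto
    also have "\<dots> = \<theta> powr (real s powr \<eta>) / \<theta>" using assms by (simp add: powr_diff)
    also have "\<dots> = (\<theta> powr (real s powr \<eta>) * real s powr (1 + 2 * \<beta>)) / \<theta> * real s powr (- (1 + 2 * \<beta>))"
      using s assms by (simp add: powr_minus del: minus_add_distrib)
    also have "\<dots> \<le> B / \<theta> * real s powr (- (1 + 2 * \<beta>))"
      using B(2)[of s] assms by (intro mult_right_mono divide_right_mono) auto
    finally have 1: "\<theta> ^ k \<le> B / \<theta> * real s powr (- (1 + 2 * \<beta>))" .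
    have "real m powr (1 - 2 * \<tau>) \<le> (real s powr (1 - \<eta>) / 2) powr (1 - 2 * \<tau>)"
      using m2 s1 s assms by (intro powr_mono2') auto
    also have "\<dots> = real s powr ((1 - \<eta>) * (1 - 2 * \<tau>)) * 2 powr (2 * \<tau> - 1)"
      using s by (simp add: powr_divide powr_powr powr_minus_divide[of 2 "2 * \<tau> - 1", simplified])
    also have "(1 - \<eta>) * (1 - 2 * \<tau>) = - (1 + 2 * \<beta>)" using \<eta>' by (simp add: algebra_simps)
    finally have 2: "real m powr (1 - 2 * \<tau>) \<le> real s powr (- (1 + 2 * \<beta>)) * 2 powr (2 * \<tau> - 1)" .
    have "\<theta> ^ k + c * real m powr (1 - 2 * \<tau>) \<le> c' * real s powr (- (1 + 2 * \<beta>))"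
      using 1 mult_left_mono[OF 2 assms(5)] by (simp add: c'_def algebra_simps)
    with km m(3) show "\<exists>k m. 1 \<le> m \<and> k * m \<le> s \<and>
       \<theta> ^ k + c * real m powr (1 - 2 * \<tau>) \<le> c' * real s powr (- (1 + 2 * \<beta>))" by blast
  qed
qed

subsection \<open>Decay of the prediction coefficients\<close>

text \<open>Indices are lags seen from one fixed time, and \<open>a l j\<close> plays the covariance
  of the entries at lags \<open>l\<close> and \<open>j\<close>. Lag 0 is excluded from
  \<open>normal\<close>: there the sum is minus the variance of the prediction error. Coercivity is
  stated for tails, which are the test vectors.\<close>

locale decaying_predictor =
  fixes \<kappa> C \<tau> :: real and N :: nat and a :: "nat \<Rightarrow> nat \<Rightarrow> real" and f :: "nat \<Rightarrow> real"
  assumes \<kappa>: "\<kappa> > 0" and C: "C > 0" and \<tau>: "\<tau> > 1"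
    and coercive: "\<And>s. \<kappa> * (\<Sum>l\<in>{s<..N}. (f l)\<^sup>2) \<le> (\<Sum>l\<in>{s<..N}. \<Sum>j\<in>{s<..N}. f l * f j * a l j)"
    and decay: "\<And>l j. l \<le> N \<Longrightarrow> j \<le> N \<Longrightarrow> \<bar>a l j\<bar> \<le> C * (1 + \<bar>real l - real j\<bar>) powr (- \<tau>)"
    and normal: "\<And>l. 1 \<le> l \<Longrightarrow> l \<le> N \<Longrightarrow> (\<Sum>j\<le>N. a l j * f j) = 0"
begin

definition tail_energy :: "nat \<Rightarrow> real" where
  "tail_energy s = (\<Sum>l\<in>{s<..N}. (f l)\<^sup>2)"

definition mass :: real where
  "mass = (\<Sum>j\<le>N. \<bar>f j\<bar>)"

lemma mass_nonneg: "mass \<ge> 0"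
  by (simp add: mass_def sum_nonneg)

lemma tail_energy_le_mass: "tail_energy s \<le> mass\<^sup>2"
proof -
  have "tail_energy s \<le> (\<Sum>l\<le>N. \<bar>f l\<bar> * \<bar>f l\<bar>)"
    unfolding tail_energy_def by (simp add: power2_eq_square) (intro sum_mono2, auto)
  also have "\<dots> \<le> (\<Sum>l\<le>N. \<bar>f l\<bar> * mass)"
    unfolding mass_def by (intro sum_mono mult_left_mono member_le_sum) auto
  also have "\<dots> = mass\<^sup>2" by (simp add: mass_def sum_distrib_right power2_eq_square)
  finally show ?thesis .
qed

lemma tail_energy_split:
  "p \<le> s \<Longrightarrow> (\<Sum>j\<in>{p<..min s N}. (f j)\<^sup>2) = tail_energy p - tail_energy s"
proof -
  assume "p \<le> s"
  then have "{p<..N} = {p<..min s N} \<union> {s<..N}" by auto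
  then have "tail_energy p = (\<Sum>j\<in>{p<..min s N}. (f j)\<^sup>2) + (\<Sum>j\<in>{s<..N}. (f j)\<^sup>2)"
    unfolding tail_energy_def by (simp only:) (rule sum.union_disjoint, auto)
  then show ?thesis by (simp add: tail_energy_def)
qed

section \<open>Interaction of a tail of lags with the lags before it\<close>

lemma weighted_AM_GM: "e > 0 \<Longrightarrow> x * y \<le> e * x\<^sup>2 + y\<^sup>2 / (4 * e)" for x y e :: real
proof -
  assume "e > 0"
  then have "e * x\<^sup>2 + y\<^sup>2 / (4 * e) - x * y = (2 * e * x - y)\<^sup>2 / (4 * e)"
    by (simp add: field_simps power2_eq_square)
  also have "\<dots> \<ge> 0" using \<open>e > 0\<close> by simp
  finally show ?thesis by simp
qed

definition row_bound :: real where
  "row_bound = C * kernel_sum \<tau>"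

lemma row_bound_pos: "row_bound > 0"
  using C kernel_sum_pos[OF \<tau>] by (simp add: row_bound_def)

lemma row_sum: "l \<le> N \<Longrightarrow> J \<subseteq> {..N} \<Longrightarrow> (\<Sum>j\<in>J. \<bar>a l j\<bar>) \<le> row_bound"
proof -
  assume *: "l \<le> N" "J \<subseteq> {..N}"
  then have "(\<Sum>j\<in>J. \<bar>a l j\<bar>) \<le> (\<Sum>j\<in>J. C * (1 + \<bar>real l - real j\<bar>) powr (- \<tau>))"
    by (intro sum_mono decay) auto
  also have "\<dots> = C * (\<Sum>j\<in>J. (1 + \<bar>real l - real j\<bar>) powr (- \<tau>))" by (simp add: sum_distrib_left)
  also have "\<dots> \<le> row_bound"
    unfolding row_bound_def using C kernel_row_sum[OF \<tau> *(2,1)] by (intro mult_left_mono) auto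
  finally show ?thesis .
qed

lemma col_sum: "j \<le> N \<Longrightarrow> J \<subseteq> {..N} \<Longrightarrow> (\<Sum>l\<in>J. \<bar>a l j\<bar>) \<le> row_bound"
proof -
  assume *: "j \<le> N" "J \<subseteq> {..N}"
  then have "(\<Sum>l\<in>J. \<bar>a l j\<bar>) \<le> (\<Sum>l\<in>J. C * (1 + \<bar>real j - real l\<bar>) powr (- \<tau>))"
    using decay by (intro sum_mono) (auto simp: abs_minus_commute)
  also have "\<dots> = C * (\<Sum>l\<in>J. (1 + \<bar>real j - real l\<bar>) powr (- \<tau>))" by (simp add: sum_distrib_left)
  also have "\<dots> \<le> row_bound"
    unfolding row_bound_def using C kernel_row_sum[OF \<tau> *(2,1)] by (intro mult_left_mono) auto
  finally show ?thesis .
qed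

text \<open>For \<open>j \<le> p\<close> the kernel is at most
  \<open>C * (l - p) powr (- \<tau>)\<close>, independently of \<open>j\<close>. The weight
  \<open>\<kappa> / 4\<close> splits off a share of tail energy that coercivity can absorb; the
  squared kernel summed over distances above \<open>m\<close> gives the power
  \<open>1 - 2 * \<tau>\<close>.\<close>

lemma far_interaction:
  assumes "1 \<le> m"
  shows "(\<Sum>l\<in>{p + m<..N}. \<Sum>j\<le>min p N. \<bar>f l\<bar> * \<bar>f j\<bar> * \<bar>a l j\<bar>)
     \<le> \<kappa> / 4 * tail_energy (p + m)
        + (C\<^sup>2 / (1 - 2 powr (1 - 2 * \<tau>)) * (\<Sum>j\<le>min p N. \<bar>f j\<bar>)\<^sup>2 * real m powr (1 - 2 * \<tau>)) / \<kappa>"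
proof -
  define S where "S = (\<Sum>j\<le>min p N. \<bar>f j\<bar>)"
  let ?I = "{p + m<..N}"
  have inner: "(\<Sum>j\<le>min p N. \<bar>f l\<bar> * \<bar>f j\<bar> * \<bar>a l j\<bar>) \<le> \<bar>f l\<bar> * (C * S * real (l - p) powr (- \<tau>))"
    if "l \<in> ?I" for l
  proof -
    have "(\<Sum>j\<le>min p N. \<bar>f l\<bar> * \<bar>f j\<bar> * \<bar>a l j\<bar>)
        \<le> (\<Sum>j\<le>min p N. \<bar>f l\<bar> * \<bar>f j\<bar> * (C * real (l - p) powr (- \<tau>)))"
    proof (intro sum_mono mult_left_mono)
      fix j assume j: "j \<in> {..min p N}"
      have "\<bar>a l j\<bar> \<le> C * (1 + \<bar>real l - real j\<bar>) powr (- \<tau>)" using that j by (intro decay) auto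
      also have "\<dots> \<le> C * real (l - p) powr (- \<tau>)"
        using that j C \<tau> by (intro mult_left_mono powr_mono2') (auto simp: of_nat_diff)
      finally show "\<bar>a l j\<bar> \<le> C * real (l - p) powr (- \<tau>)" .
    qed auto
    also have "\<dots> = \<bar>f l\<bar> * (C * S * real (l - p) powr (- \<tau>))"
      by (simp add: S_def sum_distrib_left sum_distrib_right mult_ac)
    finally show ?thesis .
  qed
  have "(\<Sum>l\<in>?I. \<Sum>j\<le>min p N. \<bar>f l\<bar> * \<bar>f j\<bar> * \<bar>a l j\<bar>)
      \<le> (\<Sum>l\<in>?I. \<kappa> / 4 * (f l)\<^sup>2 + (C * S)\<^sup>2 / \<kappa> * real (l - p) powr (- (2 * \<tau>)))"
  proof (intro sum_mono order_trans[OF inner])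
    fix l assume "l \<in> ?I"
    have "\<bar>f l\<bar> * (C * S * real (l - p) powr (- \<tau>))
        \<le> \<kappa> / 4 * \<bar>f l\<bar>\<^sup>2 + (C * S * real (l - p) powr (- \<tau>))\<^sup>2 / (4 * (\<kappa> / 4))"
      using \<kappa> by (intro weighted_AM_GM) auto
    also have "(C * S * real (l - p) powr (- \<tau>))\<^sup>2 / (4 * (\<kappa> / 4))
        = (C * S)\<^sup>2 / \<kappa> * real (l - p) powr (- (2 * \<tau>))"
      by (simp add: power2_eq_square powr_add[symmetric] mult_ac)
    finally show "\<bar>f l\<bar> * (C * S * real (l - p) powr (- \<tau>))
        \<le> \<kappa> / 4 * (f l)\<^sup>2 + (C * S)\<^sup>2 / \<kappa> * real (l - p) powr (- (2 * \<tau>))" by simp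
  qed
  also have "\<dots> = \<kappa> / 4 * tail_energy (p + m)
      + (C * S)\<^sup>2 / \<kappa> * (\<Sum>l\<in>?I. real (l - p) powr (- (2 * \<tau>)))"
    by (simp add: sum.distrib sum_distrib_left tail_energy_def)
  also have "(\<Sum>l\<in>?I. real (l - p) powr (- (2 * \<tau>))) = (\<Sum>r\<in>{m<..N - p}. real r powr (- (2 * \<tau>)))"
    by (rule sum.reindex_bij_witness[of _ "\<lambda>r. r + p" "\<lambda>l. l - p"]) auto
  also have "(C * S)\<^sup>2 / \<kappa> * \<dots>
      \<le> (C * S)\<^sup>2 / \<kappa> * (1 / (1 - 2 powr (1 - 2 * \<tau>)) * real m powr (1 - 2 * \<tau>))"
    using \<kappa> \<tau> assms by (intro mult_left_mono powr_sum_tail) auto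
  finally show ?thesis by (simp add: S_def power_mult_distrib mult_ac)
qed

text \<open>A Schur test: after the weighted splitting of \<open>f l\<close> and \<open>f j\<close>,
  the kernel is summed out along rows or columns.\<close>

lemma near_interaction:
  assumes "p \<le> s"
  shows "(\<Sum>l\<in>{s<..N}. \<Sum>j\<in>{p<..min s N}. \<bar>f l\<bar> * \<bar>f j\<bar> * \<bar>a l j\<bar>)
     \<le> \<kappa> / 4 * tail_energy s + row_bound\<^sup>2 / \<kappa> * (tail_energy p - tail_energy s)"
proof -
  let ?I = "{s<..N}" and ?J = "{p<..min s N}"
  \<comment> \<open>Summing out the kernel costs a factor \<open>row_bound\<close>, so with this
    weight the tail pays exactly \<open>\<kappa> / 4\<close> of its energy.\<close>
  let ?e = "\<kappa> / (4 * row_bound)"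
  note K = row_bound_pos
  have "(\<Sum>l\<in>?I. \<Sum>j\<in>?J. \<bar>f l\<bar> * \<bar>f j\<bar> * \<bar>a l j\<bar>)
      \<le> (\<Sum>l\<in>?I. \<Sum>j\<in>?J. ?e * (f l)\<^sup>2 * \<bar>a l j\<bar> + row_bound / \<kappa> * (f j)\<^sup>2 * \<bar>a l j\<bar>)"
  proof (intro sum_mono)
    fix l j
    have "\<bar>f l\<bar> * \<bar>f j\<bar> \<le> ?e * \<bar>f l\<bar>\<^sup>2 + \<bar>f j\<bar>\<^sup>2 / (4 * ?e)"
      using \<kappa> K by (intro weighted_AM_GM) auto
    also have "\<dots> = ?e * (f l)\<^sup>2 + row_bound / \<kappa> * (f j)\<^sup>2" using \<kappa> K by simp
    finally have "\<bar>f l\<bar> * \<bar>f j\<bar> * \<bar>a l j\<bar> \<le> (?e * (f l)\<^sup>2 + row_bound / \<kappa> * (f j)\<^sup>2) * \<bar>a l j\<bar>"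
      by (rule mult_right_mono) auto
    then show "\<bar>f l\<bar> * \<bar>f j\<bar> * \<bar>a l j\<bar> \<le> ?e * (f l)\<^sup>2 * \<bar>a l j\<bar> + row_bound / \<kappa> * (f j)\<^sup>2 * \<bar>a l j\<bar>"
      by (simp add: distrib_right)
  qed
  also have "\<dots> = (\<Sum>l\<in>?I. ?e * (f l)\<^sup>2 * (\<Sum>j\<in>?J. \<bar>a l j\<bar>))
      + (\<Sum>j\<in>?J. row_bound / \<kappa> * (f j)\<^sup>2 * (\<Sum>l\<in>?I. \<bar>a l j\<bar>))"
    by (simp only: sum.distrib sum_distrib_left sum.swap[of _ ?J ?I])
  also have "\<dots> \<le> (\<Sum>l\<in>?I. ?e * (f l)\<^sup>2 * row_bound) + (\<Sum>j\<in>?J. row_bound / \<kappa> * (f j)\<^sup>2 * row_bound)"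
    using \<kappa> K by (intro add_mono sum_mono mult_left_mono row_sum col_sum) auto
  also have "\<dots> = \<kappa> / 4 * tail_energy s + row_bound\<^sup>2 / \<kappa> * (tail_energy p - tail_energy s)"
    unfolding tail_energy_split[OF assms, symmetric] unfolding tail_energy_def using K
    by (simp add: sum_distrib_left power2_eq_square mult_ac)
  finally show ?thesis .
qed

text \<open>Rows beyond \<open>s\<close> have lag at least one, so their normal equations hold: the
  part of such a row inside the tail is minus the part before it. This turns the coercive form into
  an interaction.\<close>

lemma tail_interaction:
  "\<kappa> * tail_energy s \<le> (\<Sum>l\<in>{s<..N}. \<Sum>j\<le>min s N. \<bar>f l\<bar> * \<bar>f j\<bar> * \<bar>a l j\<bar>)"
proof -
  have "\<kappa> * tail_energy s \<le> (\<Sum>l\<in>{s<..N}. \<Sum>j\<in>{s<..N}. f l * f j * a l j)"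
    unfolding tail_energy_def by (rule coercive)
  also have "\<dots> = (\<Sum>l\<in>{s<..N}. - (\<Sum>j\<le>min s N. f l * f j * a l j))"
  proof (intro sum.cong refl)
    fix l assume l: "l \<in> {s<..N}"
    have un: "{..N} = {..min s N} \<union> {s<..N}" by auto
    have "(\<Sum>j\<le>N. f l * f j * a l j) = f l * (\<Sum>j\<le>N. a l j * f j)"
      by (simp add: sum_distrib_left mult_ac)
    also have "\<dots> = 0" using normal[of l] l by simp
    finally have "(\<Sum>j\<le>N. f l * f j * a l j) = 0" .
    moreover have "(\<Sum>j\<le>N. f l * f j * a l j)
        = (\<Sum>j\<le>min s N. f l * f j * a l j) + (\<Sum>j\<in>{s<..N}. f l * f j * a l j)"
      unfolding un by (rule sum.union_disjoint) auto
    ultimately show "(\<Sum>j\<in>{s<..N}. f l * f j * a l j) = - (\<Sum>j\<le>min s N. f l * f j * a l j)"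
      by simp
  qed
  also have "\<dots> \<le> (\<Sum>l\<in>{s<..N}. \<Sum>j\<le>min s N. \<bar>f l\<bar> * \<bar>f j\<bar> * \<bar>a l j\<bar>)"
  proof (intro sum_mono)
    fix l
    have "- (\<Sum>j\<le>min s N. f l * f j * a l j) \<le> \<bar>\<Sum>j\<le>min s N. f l * f j * a l j\<bar>" by simp
    also have "\<dots> \<le> (\<Sum>j\<le>min s N. \<bar>f l * f j * a l j\<bar>)" by (rule sum_abs)
    finally show "- (\<Sum>j\<le>min s N. f l * f j * a l j) \<le> (\<Sum>j\<le>min s N. \<bar>f l\<bar> * \<bar>f j\<bar> * \<bar>a l j\<bar>)"
      by (simp add: abs_mult)
  qed
  finally show ?thesis .
qed

text \<open>For \<open>s = 0\<close> the tail interacts with lag 0 only, where the coefficient has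
  modulus one. Since \<open>a l 0\<close> is at most \<open>C\<close>, its square sum is at most
  \<open>C * row_bound\<close>; half of the energy is absorbed.\<close>

lemma energy_bound:
  assumes "\<bar>f 0\<bar> = 1"
  shows "tail_energy 0 \<le> C * row_bound / \<kappa>\<^sup>2"
proof -
  have fin: "(\<Sum>l\<in>{0<..N}. \<Sum>j\<le>min 0 N. \<bar>f l\<bar> * \<bar>f j\<bar> * \<bar>a l j\<bar>) = (\<Sum>l\<in>{0<..N}. \<bar>f l\<bar> * \<bar>a l 0\<bar>)"
    using assms by simp
  have "\<kappa> * tail_energy 0 \<le> (\<Sum>l\<in>{0<..N}. \<bar>f l\<bar> * \<bar>a l 0\<bar>)"
    using tail_interaction[of 0] fin by simp
  also have "\<dots> \<le> (\<Sum>l\<in>{0<..N}. \<kappa> / 2 * (f l)\<^sup>2 + C / (2 * \<kappa>) * \<bar>a l 0\<bar>)"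
  proof (intro sum_mono)
    fix l assume l: "l \<in> {0<..N}"
    have "\<bar>f l\<bar> * \<bar>a l 0\<bar> \<le> \<kappa> / 2 * \<bar>f l\<bar>\<^sup>2 + \<bar>a l 0\<bar>\<^sup>2 / (4 * (\<kappa> / 2))"
      using \<kappa> by (intro weighted_AM_GM) auto
    also have "\<bar>a l 0\<bar>\<^sup>2 \<le> C * \<bar>a l 0\<bar>"
    proof -
      have "\<bar>a l 0\<bar> \<le> C * (1 + \<bar>real l - real 0\<bar>) powr (- \<tau>)" using l by (intro decay) auto
      also have "\<dots> \<le> C * 1 powr (- \<tau>)" using C \<tau> by (intro mult_left_mono powr_mono2') auto
      finally show ?thesis using mult_right_mono[of "\<bar>a l 0\<bar>" C "\<bar>a l 0\<bar>"] by (simp add: power2_eq_square)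
    qed
    finally show "\<bar>f l\<bar> * \<bar>a l 0\<bar> \<le> \<kappa> / 2 * (f l)\<^sup>2 + C / (2 * \<kappa>) * \<bar>a l 0\<bar>"
      using \<kappa> by (simp add: divide_right_mono)
  qed
  also have "\<dots> = \<kappa> / 2 * tail_energy 0 + C / (2 * \<kappa>) * (\<Sum>l\<in>{0<..N}. \<bar>a l 0\<bar>)"
    by (simp add: sum.distrib sum_distrib_left tail_energy_def)
  also have "\<dots> \<le> \<kappa> / 2 * tail_energy 0 + C / (2 * \<kappa>) * row_bound"
    using C \<kappa> by (intro add_left_mono mult_left_mono col_sum) auto
  finally have "\<kappa> / 2 * tail_energy 0 \<le> C / (2 * \<kappa>) * row_bound" by simp
  then show ?thesis using \<kappa> by (simp add: field_simps power2_eq_square)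
qed

section \<open>Geometric decay of the tail energies\<close>

definition contraction :: real where
  "contraction = row_bound\<^sup>2 / (\<kappa>\<^sup>2 / 2 + row_bound\<^sup>2)"

definition source :: real where
  "source = C\<^sup>2 / (1 - 2 powr (1 - 2 * \<tau>)) / (\<kappa>\<^sup>2 / 2 + row_bound\<^sup>2)"

lemma contraction: "0 < contraction" "contraction < 1"
  using row_bound_pos \<kappa> by (auto simp: contraction_def add_pos_pos)

lemma source_nonneg: "source \<ge> 0"
proof -
  have "2 powr (1 - 2 * \<tau>) \<le> (2::real) powr 0" using \<tau> by (intro powr_mono) auto
  then show ?thesis by (auto simp: source_def intro!: divide_nonneg_nonneg add_nonneg_nonneg)
qed

text \<open>Widman's hole-filling trick: testing the normal equations with the tail of \<^term>\<open>f\<close> bounds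
  the energy beyond \<open>p + m\<close> by the energy of the annulus \<open>{p<..p + m}\<close>; adding a multiple of the
  left-hand side fills the hole.\<close>

lemma hole_filling:
  assumes "1 \<le> m"
  shows "tail_energy (p + m) \<le> contraction * tail_energy p + source * mass\<^sup>2 * real m powr (1 - 2 * \<tau>)"
proof -
  let ?s = "p + m"
  let ?Z = "C\<^sup>2 / (1 - 2 powr (1 - 2 * \<tau>))"
  have Z: "?Z \<ge> 0"
  proof -
    have "2 powr (1 - 2 * \<tau>) \<le> (2::real) powr 0" using \<tau> by (intro powr_mono) auto
    then show ?thesis by simp
  qed
  have "\<kappa> * tail_energy ?s \<le> (\<Sum>l\<in>{?s<..N}. \<Sum>j\<le>min ?s N. \<bar>f l\<bar> * \<bar>f j\<bar> * \<bar>a l j\<bar>)"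
    by (rule tail_interaction)
  \<comment> \<open>The lags before the tail are split into those at distance at least
    \<open>m\<close> and the annulus.\<close>
  also have "{..min ?s N} = {..min p N} \<union> {p<..min ?s N}" by auto
  also have "(\<Sum>l\<in>{?s<..N}. \<Sum>j\<in>{..min p N} \<union> {p<..min ?s N}. \<bar>f l\<bar> * \<bar>f j\<bar> * \<bar>a l j\<bar>)
      = (\<Sum>l\<in>{?s<..N}. \<Sum>j\<le>min p N. \<bar>f l\<bar> * \<bar>f j\<bar> * \<bar>a l j\<bar>)
        + (\<Sum>l\<in>{?s<..N}. \<Sum>j\<in>{p<..min ?s N}. \<bar>f l\<bar> * \<bar>f j\<bar> * \<bar>a l j\<bar>)"
    unfolding sum.distrib[symmetric] by (intro sum.cong refl sum.union_disjoint) auto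
  also have "\<dots> \<le> (\<kappa> / 4 * tail_energy ?s + (?Z * (\<Sum>j\<le>min p N. \<bar>f j\<bar>)\<^sup>2 * real m powr (1 - 2 * \<tau>)) / \<kappa>)
      + (\<kappa> / 4 * tail_energy ?s + row_bound\<^sup>2 / \<kappa> * (tail_energy p - tail_energy ?s))"
    by (intro add_mono far_interaction near_interaction assms) auto
  also have "\<dots> \<le> (\<kappa> / 4 * tail_energy ?s + (?Z * mass\<^sup>2 * real m powr (1 - 2 * \<tau>)) / \<kappa>)
      + (\<kappa> / 4 * tail_energy ?s + row_bound\<^sup>2 / \<kappa> * (tail_energy p - tail_energy ?s))"
  proof (intro add_right_mono add_left_mono divide_right_mono mult_right_mono mult_left_mono)
    show "(\<Sum>j\<le>min p N. \<bar>f j\<bar>)\<^sup>2 \<le> mass\<^sup>2"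
      unfolding mass_def by (intro power_mono sum_mono2 sum_nonneg) auto
  qed (use Z \<kappa> in auto)
  finally have "\<kappa> * tail_energy ?s \<le>
      (\<kappa> / 4 * tail_energy ?s + (?Z * mass\<^sup>2 * real m powr (1 - 2 * \<tau>)) / \<kappa>)
      + (\<kappa> / 4 * tail_energy ?s + row_bound\<^sup>2 / \<kappa> * (tail_energy p - tail_energy ?s))"
    .
  then have "\<kappa> * (\<kappa> * tail_energy ?s) \<le>
      \<kappa> * ((\<kappa> / 4 * tail_energy ?s + (?Z * mass\<^sup>2 * real m powr (1 - 2 * \<tau>)) / \<kappa>)
      + (\<kappa> / 4 * tail_energy ?s + row_bound\<^sup>2 / \<kappa> * (tail_energy p - tail_energy ?s)))"
    using \<kappa> by (intro mult_left_mono) auto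
  also have "\<dots> = \<kappa>\<^sup>2 / 2 * tail_energy ?s + ?Z * mass\<^sup>2 * real m powr (1 - 2 * \<tau>)
      + row_bound\<^sup>2 * (tail_energy p - tail_energy ?s)"
    using \<kappa> by (simp add: distrib_left power2_eq_square)
  \<comment> \<open>The two shares \<open>\<kappa> / 4\<close> leave half of the coercivity, hence
    \<open>\<kappa>\<^sup>2 / 2\<close>; the negative tail energy of the annulus term moves to the
    left and adds \<open>row_bound\<^sup>2\<close>. Division by this sum gives
    \<open>contraction\<close> and \<open>source\<close>.\<close>
  finally have "tail_energy ?s * (\<kappa>\<^sup>2 / 2 + row_bound\<^sup>2)
      \<le> row_bound\<^sup>2 * tail_energy p + ?Z * mass\<^sup>2 * real m powr (1 - 2 * \<tau>)"
    by (simp add: algebra_simps power2_eq_square)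
  then have "tail_energy ?s
      \<le> (row_bound\<^sup>2 * tail_energy p + ?Z * mass\<^sup>2 * real m powr (1 - 2 * \<tau>)) / (\<kappa>\<^sup>2 / 2 + row_bound\<^sup>2)"
    using \<kappa> by (subst pos_le_divide_eq) (auto intro!: add_pos_nonneg)
  then show ?thesis by (simp add: contraction_def source_def add_divide_distrib)
qed

text \<open>With a fixed step length the source terms form a geometric series, bounded by
  \<open>source / (1 - contraction)\<close>, the fixed point of the recursion.\<close>

lemma hole_filling_iterate:
  assumes "1 \<le> m"
  shows "tail_energy (k * m) \<le>
    mass\<^sup>2 * (contraction ^ k + source / (1 - contraction) * real m powr (1 - 2 * \<tau>))"
proof (induction k)
  case 0
  have "tail_energy 0 \<le> mass\<^sup>2 * 1" using tail_energy_le_mass by simp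
  also have "\<dots> \<le> mass\<^sup>2 * (1 + source / (1 - contraction) * real m powr (1 - 2 * \<tau>))"
    using source_nonneg contraction by (intro mult_left_mono) auto
  finally show ?case by simp
next
  case (Suc k)
  let ?R = "real m powr (1 - 2 * \<tau>)"
  have "tail_energy (Suc k * m) \<le> contraction * tail_energy (k * m) + source * mass\<^sup>2 * ?R"
    using hole_filling[OF assms, of "k * m"] by (simp add: add.commute)
  also have "\<dots> \<le> contraction * (mass\<^sup>2 * (contraction ^ k + source / (1 - contraction) * ?R))
      + source * mass\<^sup>2 * ?R"
    using Suc contraction by (intro add_right_mono mult_left_mono) auto
  also have "\<dots> = mass\<^sup>2 * (contraction ^ Suc k + source / (1 - contraction) * ?R)"
  proof -
    have "contraction * (source / (1 - contraction)) + source = source / (1 - contraction)"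
      using contraction by (simp add: field_simps)
    then have "mass\<^sup>2 * (contraction ^ Suc k + source / (1 - contraction) * ?R)
      = mass\<^sup>2 * (contraction ^ Suc k + (contraction * (source / (1 - contraction)) + source) * ?R)"
      by simp
    also have "\<dots> = contraction * (mass\<^sup>2 * (contraction ^ k + source / (1 - contraction) * ?R))
        + source * mass\<^sup>2 * ?R"
      by (simp only: power_Suc ring_distribs mult_ac add_ac)
    finally show ?thesis by simp
  qed
  finally show ?case .
qed

section \<open>From tail energies to tails of absolute sums\<close>

lemma tail_energy_antimono: "p \<le> s \<Longrightarrow> tail_energy s \<le> tail_energy p"
  unfolding tail_energy_def by (intro sum_mono2) auto

lemma l1_block: "(\<Sum>j\<in>{s<..min t N}. \<bar>f j\<bar>) \<le> sqrt (real (t - s) * tail_energy s)"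
proof (rule real_le_rsqrt)
  have "(\<Sum>j\<in>{s<..min t N}. \<bar>f j\<bar> * 1)\<^sup>2 \<le> (\<Sum>j\<in>{s<..min t N}. \<bar>f j\<bar>\<^sup>2) * (\<Sum>j\<in>{s<..min t N}. 1\<^sup>2)"
    by (rule Cauchy_Schwarz_ineq_sum)
  also have "\<dots> \<le> tail_energy s * real (t - s)"
    unfolding tail_energy_def by (intro mult_mono) (auto intro!: sum_mono2 sum_nonneg)
  finally show "(\<Sum>j\<in>{s<..min t N}. \<bar>f j\<bar>)\<^sup>2 \<le> real (t - s) * tail_energy s"
    by (simp add: mult.commute)
qed

text \<open>The energy beyond \<open>s\<close> is of order
  \<open>mass\<^sup>2 * s powr (- (1 + 2 * \<beta>))\<close>. Cauchy-Schwarz over at most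
  \<open>s\<close> terms of a dyadic block loses \<open>sqrt s\<close>, which leaves
  \<open>mass * s powr (- \<beta>)\<close> per block.\<close>

lemma l1_tail:
  assumes "\<beta> > 0" "c \<ge> 0"
    and scales: "\<forall>s\<ge>1. \<exists>k m. 1 \<le> m \<and> k * m \<le> s \<and> contraction ^ k
      + source / (1 - contraction) * real m powr (1 - 2 * \<tau>) \<le> c * real s powr (- (1 + 2 * \<beta>))"
    and "1 \<le> s"
  shows "(\<Sum>j\<in>{s<..N}. \<bar>f j\<bar>) \<le> mass * sqrt c / (1 - 2 powr (- \<beta>)) * real s powr (- \<beta>)"
proof (rule dyadic_tail)
  show "mass * sqrt c \<ge> 0" using mass_nonneg assms by simp
next
  fix s :: nat assume s: "1 \<le> s"
  then obtain k m where km: "1 \<le> m" "k * m \<le> s" and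
    le: "contraction ^ k + source / (1 - contraction) * real m powr (1 - 2 * \<tau>)
      \<le> c * real s powr (- (1 + 2 * \<beta>))"
    using scales by blast
  have "tail_energy s \<le> tail_energy (k * m)" by (rule tail_energy_antimono[OF km(2)])
  also have "\<dots> \<le> mass\<^sup>2 * (c * real s powr (- (1 + 2 * \<beta>)))"
    using hole_filling_iterate[OF km(1), of k] mult_left_mono[OF le, of "mass\<^sup>2"] by simp
  finally have T: "tail_energy s \<le> mass\<^sup>2 * (c * real s powr (- (1 + 2 * \<beta>)))" .
  have "(\<Sum>j\<in>{s<..min (2 * s) N}. \<bar>f j\<bar>) \<le> sqrt (real s * tail_energy s)"
    using l1_block[of s "2 * s"] by simp
  also have "\<dots> \<le> sqrt (real s * (mass\<^sup>2 * (c * real s powr (- (1 + 2 * \<beta>)))))"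
    using T by (intro real_sqrt_le_mono mult_left_mono) auto
  also have "real s * (mass\<^sup>2 * (c * real s powr (- (1 + 2 * \<beta>))))
      = c * (mass * real s powr (- \<beta>))\<^sup>2"
    using s by (simp add: power2_eq_square powr_add[symmetric] powr_mult_base)
  also have "sqrt \<dots> = mass * sqrt c * real s powr (- \<beta>)"
    using mass_nonneg by (simp add: real_sqrt_mult abs_mult)
  finally show "(\<Sum>j\<in>{s<..min (2 * s) N}. \<bar>f j\<bar>) \<le> mass * sqrt c * real s powr (- \<beta>)" .
qed (use assms in auto)

text \<open>Removes the factor \<open>mass\<close> from \<open>l1_tail\<close>: if half of the mass
  bounds the tail beyond \<open>S\<close>, that half is absorbed, and the first \<open>S\<close>
  lags are controlled by the energy through Cauchy-Schwarz.\<close>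

lemma mass_le:
  assumes "\<bar>f 0\<bar> = 1" and "(\<Sum>j\<in>{S<..N}. \<bar>f j\<bar>) \<le> mass / 2"
  shows "mass \<le> 2 * (1 + sqrt (real S * (C * row_bound / \<kappa>\<^sup>2)))"
proof -
  have "{..N} = insert 0 ({0<..min S N} \<union> {S<..N})" by auto
  then have "mass = \<bar>f 0\<bar> + ((\<Sum>j\<in>{0<..min S N}. \<bar>f j\<bar>) + (\<Sum>j\<in>{S<..N}. \<bar>f j\<bar>))"
    unfolding mass_def by (simp only:) (subst sum.insert, auto intro!: sum.union_disjoint)
  also have "\<dots> \<le> 1 + (sqrt (real S * (C * row_bound / \<kappa>\<^sup>2)) + mass / 2)"
  proof (intro add_mono)
    have "(\<Sum>j\<in>{0<..min S N}. \<bar>f j\<bar>) \<le> sqrt (real S * tail_energy 0)"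
      using l1_block[of 0 S] by simp
    also have "\<dots> \<le> sqrt (real S * (C * row_bound / \<kappa>\<^sup>2))"
      by (intro real_sqrt_le_mono mult_left_mono energy_bound assms) auto
    finally show "(\<Sum>j\<in>{0<..min S N}. \<bar>f j\<bar>) \<le> sqrt (real S * (C * row_bound / \<kappa>\<^sup>2))" .
  qed (use assms in auto)
  finally show ?thesis by simp
qed

end

text \<open>The constant is chosen before \<open>N\<close>, \<open>a\<close> and \<open>f\<close>,
  which is the source of uniformity in time and row. This is possible as \<open>contraction\<close>,
  \<open>source\<close> and \<open>row_bound\<close> depend on \<open>\<kappa>\<close>,
  \<open>C\<close> and \<open>\<tau>\<close> only.\<close>

lemma decaying_predictor_l1:
  assumes "\<kappa> > 0" "C > 0" "0 < \<beta>" "\<beta> < \<tau> - 1"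
  shows "\<exists>c>0. \<forall>N a f. decaying_predictor \<kappa> C \<tau> N a f \<longrightarrow> \<bar>f 0\<bar> = 1 \<longrightarrow>
    (\<Sum>j\<le>N. \<bar>f j\<bar>) \<le> c \<and> (\<forall>s\<ge>1. (\<Sum>j\<in>{s<..N}. \<bar>f j\<bar>) \<le> c * real s powr (- \<beta>))"
proof -
  \<comment> \<open>The zero predictor serves only to make the facts on these constants available
    before a predictor is fixed.\<close>
  interpret trivial: decaying_predictor \<kappa> C \<tau> 0 "\<lambda>_ _. 0" "\<lambda>_. 0"
    using assms by unfold_locales auto
  let ?\<theta> = "decaying_predictor.contraction \<kappa> C \<tau>" and ?\<sigma> = "decaying_predictor.source \<kappa> C \<tau>"
  obtain c where c: "c \<ge> 0" and scales: "\<forall>s\<ge>1. \<exists>k m. 1 \<le> m \<and> k * m \<le> s \<and>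
     ?\<theta> ^ k + ?\<sigma> / (1 - ?\<theta>) * real m powr (1 - 2 * \<tau>) \<le> c * real s powr (- (1 + 2 * \<beta>))"
    using geometric_plus_power_le[of ?\<theta> \<beta> \<tau> "?\<sigma> / (1 - ?\<theta>)"] assms trivial.contraction trivial.source_nonneg
    by auto
  define q where "q = sqrt c / (1 - 2 powr (- \<beta>))"
  have "2 powr (- \<beta>) < (2::real) powr 0" using assms by (intro powr_less_mono) auto
  then have q: "q \<ge> 0" using c by (simp add: q_def)
  have "(\<lambda>S::nat. q * real S powr (- \<beta>)) \<longlonglongrightarrow> 0" using assms by real_asymp
  then have "\<forall>\<^sub>F S in sequentially. q * real S powr (- \<beta>) < 1 / 2"
    by (rule order_tendstoD) simp
  then have "\<forall>\<^sub>F S in sequentially. q * real S powr (- \<beta>) < 1 / 2 \<and> S \<ge> 1"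
    by (intro eventually_conj eventually_ge_at_top)
  \<comment> \<open>Beyond this cutoff \<open>l1_tail\<close> yields at most half of the mass, as
    \<open>mass_le\<close> requires.\<close>
  then obtain S where S: "q * real S powr (- \<beta>) < 1 / 2" "S \<ge> 1"
    by (auto simp: eventually_at_top_linorder)
  define m where "m = 2 * (1 + sqrt (real S * (C * decaying_predictor.row_bound C \<tau> / \<kappa>\<^sup>2)))"
  have m: "m > 0" unfolding m_def using assms trivial.row_bound_pos by (intro mult_pos_pos add_pos_nonneg) auto
  show ?thesis
  proof (intro exI[of _ "m + m * q"] conjI allI impI)
    show "0 < m + m * q" using m q by (simp add: add_pos_nonneg)
    fix N a and f :: "nat \<Rightarrow> real"
    assume "decaying_predictor \<kappa> C \<tau> N a f" and f0: "\<bar>f 0\<bar> = 1"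
    then interpret decaying_predictor \<kappa> C \<tau> N a f by simp
    have tail: "(\<Sum>j\<in>{s<..N}. \<bar>f j\<bar>) \<le> mass * (q * real s powr (- \<beta>))" if "1 \<le> s" for s
      using l1_tail[OF assms(3) c scales that] by (simp add: q_def)
    have "(\<Sum>j\<in>{S<..N}. \<bar>f j\<bar>) \<le> mass * (1 / 2)"
      using tail[OF S(2)] mult_left_mono[OF less_imp_le[OF S(1)] mass_nonneg] by linarith
    then have mass: "mass \<le> m" using mass_le[OF f0, of S] by (simp add: m_def)
    then show "(\<Sum>j\<le>N. \<bar>f j\<bar>) \<le> m + m * q" using m q by (simp add: mass_def add_increasing2)
    fix s :: nat assume s: "1 \<le> s"
    have "(\<Sum>j\<in>{s<..N}. \<bar>f j\<bar>) \<le> mass * (q * real s powr (- \<beta>))" by (rule tail[OF s])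
    also have "\<dots> \<le> m * (q * real s powr (- \<beta>))" using mass q by (intro mult_right_mono) auto
    also have "\<dots> \<le> (m + m * q) * real s powr (- \<beta>)" using m by (simp add: algebra_simps)
    finally show "(\<Sum>j\<in>{s<..N}. \<bar>f j\<bar>) \<le> (m + m * q) * real s powr (- \<beta>)" .
  qed
qed

subsection \<open>Innovation coefficients\<close>

text \<open>One row of the array: \<open>G\<close> is the covariance in time indices and
  \<open>\<phi> i\<close> holds the coefficients at time \<open>i\<close>. Coercivity on every index
  set covers all principal submatrices.\<close>

locale prediction_kernel =
  fixes \<kappa> C \<tau> :: real and n :: nat and G :: "nat \<Rightarrow> nat \<Rightarrow> real" and \<phi> :: "nat \<Rightarrow> nat \<Rightarrow> real"
  assumes \<kappa>: "\<kappa> > 0" and C: "C > 0" and \<tau>: "\<tau> > 1"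
    and sym: "\<And>i j. i \<in> {1..n} \<Longrightarrow> j \<in> {1..n} \<Longrightarrow> G i j = G j i"
    and coercive: "\<And>I v. I \<subseteq> {1..n} \<Longrightarrow> \<kappa> * (\<Sum>i\<in>I. (v i)\<^sup>2) \<le> (\<Sum>i\<in>I. \<Sum>j\<in>I. v i * v j * G i j)"
    and decay: "\<And>i j. i \<in> {1..n} \<Longrightarrow> j \<in> {1..n} \<Longrightarrow> \<bar>G i j\<bar> \<le> C * (1 + \<bar>real i - real j\<bar>) powr (- \<tau>)"
    and normal: "\<And>i l. i \<in> {1..n} \<Longrightarrow> 1 \<le> l \<Longrightarrow> l < i \<Longrightarrow> G i l = (\<Sum>j = 1..i - 1. \<phi> i j * G (i - j) l)"
begin

definition error_coeff :: "nat \<Rightarrow> nat \<Rightarrow> real" where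
  "error_coeff i j = (if j = 0 then -1 else \<phi> i j)"

lemma sum_error_coeff:
  "(\<Sum>j\<le>i - 1. error_coeff i j * g j) = - g 0 + (\<Sum>j = 1..i - 1. \<phi> i j * g j)"
proof -
  have "{..i - 1} = insert 0 {1..i - 1}" by auto
  then show ?thesis by (simp add: error_coeff_def)
qed

lemma sum_abs_error_coeff: "(\<Sum>j\<le>i - 1. \<bar>error_coeff i j\<bar>) = 1 + (\<Sum>j = 1..i - 1. \<bar>\<phi> i j\<bar>)"
proof -
  have "{..i - 1} = insert 0 {1..i - 1}" by auto
  then show ?thesis by (simp add: error_coeff_def)
qed

text \<open>The reflection \<open>l = i - r\<close> maps the lags beyond \<open>s\<close> to the
  times from \<open>1\<close> to \<open>i - s - 1\<close>; it preserves distances and hence the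
  decay.\<close>

lemma decaying_predictor:
  assumes i: "i \<in> {1..n}"
  shows "decaying_predictor \<kappa> C \<tau> (i - 1) (\<lambda>l j. G (i - l) (i - j)) (error_coeff i)"
proof
  fix s
  let ?f = "error_coeff i" and ?R = "{1..<i - s}"
  have re: "(\<Sum>l\<in>{s<..i - 1}. g l) = (\<Sum>r\<in>?R. g (i - r))" for g :: "nat \<Rightarrow> real"
    by (rule sum.reindex_bij_witness[of _ "\<lambda>r. i - r" "\<lambda>l. i - l"]) (use i in auto)
  have "\<kappa> * (\<Sum>l\<in>{s<..i - 1}. (?f l)\<^sup>2) = \<kappa> * (\<Sum>r\<in>?R. (?f (i - r))\<^sup>2)" by (simp only: re)
  also have "\<dots> \<le> (\<Sum>r\<in>?R. \<Sum>t\<in>?R. ?f (i - r) * ?f (i - t) * G r t)"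
    using i by (intro coercive) auto
  also have "\<dots> = (\<Sum>l\<in>{s<..i - 1}. \<Sum>j\<in>{s<..i - 1}. ?f l * ?f j * G (i - l) (i - j))"
    unfolding re by (intro sum.cong) auto
  finally show "\<kappa> * (\<Sum>l\<in>{s<..i - 1}. (?f l)\<^sup>2)
      \<le> (\<Sum>l\<in>{s<..i - 1}. \<Sum>j\<in>{s<..i - 1}. ?f l * ?f j * G (i - l) (i - j))" .
next
  fix l j assume lj: "l \<le> i - 1" "j \<le> i - 1"
  have "\<bar>G (i - l) (i - j)\<bar> \<le> C * (1 + \<bar>real (i - l) - real (i - j)\<bar>) powr (- \<tau>)"
    using i lj by (intro decay) auto
  then show "\<bar>G (i - l) (i - j)\<bar> \<le> C * (1 + \<bar>real l - real j\<bar>) powr (- \<tau>)"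
    using i lj by (simp add: of_nat_diff abs_minus_commute)
next
  fix l assume l: "1 \<le> l" "l \<le> i - 1"
  have "(\<Sum>j\<le>i - 1. G (i - l) (i - j) * error_coeff i j)
      = - G (i - l) i + (\<Sum>j = 1..i - 1. \<phi> i j * G (i - l) (i - j))"
    using sum_error_coeff[of i "\<lambda>j. G (i - l) (i - j)"] by (simp add: mult.commute)
  also have "(\<Sum>j = 1..i - 1. \<phi> i j * G (i - l) (i - j)) = (\<Sum>j = 1..i - 1. \<phi> i j * G (i - j) (i - l))"
    using i l by (intro sum.cong arg_cong2[where f = "(*)"] sym) auto
  also have "\<dots> = G i (i - l)" using i l by (intro normal[symmetric]) auto
  also have "G (i - l) i = G i (i - l)" using i l by (intro sym) auto
  finally show "(\<Sum>j\<le>i - 1. G (i - l) (i - j) * error_coeff i j) = 0" by simp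
qed (use \<kappa> C \<tau> in auto)

text \<open>The covariance of the entry at time \<open>i\<close> with the prediction error at time
  \<open>j\<close>, expanded through \<open>G\<close>.\<close>

definition innov_cov :: "nat \<Rightarrow> nat \<Rightarrow> real" where
  "innov_cov i j = G i j - (\<Sum>k = 1..j - 1. \<phi> j k * G i (j - k))"

text \<open>A prediction error is uncorrelated with the past: these are the normal equations of
  \<open>j\<close> tested at \<open>i\<close>.\<close>

lemma innov_cov_upper:
  assumes "1 \<le> i" "i < j" "j \<le> n"
  shows "innov_cov i j = 0"
proof -
  have "(\<Sum>k = 1..j - 1. \<phi> j k * G i (j - k)) = (\<Sum>k = 1..j - 1. \<phi> j k * G (j - k) i)"
    using assms by (intro sum.cong arg_cong2[where f = "(*)"] sym) auto
  also have "\<dots> = G j i" using assms by (intro normal[symmetric]) auto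
  also have "\<dots> = G i j" using assms by (intro sym) auto
  finally show ?thesis by (simp add: innov_cov_def)
qed

text \<open>The error at time \<open>j\<close> is built from entries up to \<open>j\<close>, all in
  the past of \<open>i\<close>. The error at time \<open>i\<close> is therefore uncorrelated with
  it, by the normal equations of \<open>i\<close> applied to each term.\<close>

lemma innov_cov_recursion:
  assumes "1 \<le> j" "j < i" "i \<le> n"
  shows "innov_cov i j = (\<Sum>k = 1..i - 1. \<phi> i k * innov_cov (i - k) j)"
proof -
  have "(\<Sum>k = 1..i - 1. \<phi> i k * innov_cov (i - k) j)
      = (\<Sum>k = 1..i - 1. \<phi> i k * G (i - k) j)
        - (\<Sum>k = 1..i - 1. \<Sum>r = 1..j - 1. \<phi> i k * (\<phi> j r * G (i - k) (j - r)))"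
    by (simp add: innov_cov_def right_diff_distrib sum_subtractf sum_distrib_left)
  also have "(\<Sum>k = 1..i - 1. \<Sum>r = 1..j - 1. \<phi> i k * (\<phi> j r * G (i - k) (j - r)))
      = (\<Sum>r = 1..j - 1. \<phi> j r * (\<Sum>k = 1..i - 1. \<phi> i k * G (i - k) (j - r)))"
    by (subst sum.swap) (simp add: sum_distrib_left mult_ac)
  also have "\<dots> = (\<Sum>r = 1..j - 1. \<phi> j r * G i (j - r))"
    using assms by (intro sum.cong arg_cong2[where f = "(*)"] normal[symmetric] refl) auto
  also have "(\<Sum>k = 1..i - 1. \<phi> i k * G (i - k) j) = G i j"
    using assms by (intro normal[symmetric]) auto
  finally show ?thesis by (simp add: innov_cov_def)
qed

text \<open>The innovation variance is the covariance form at the vector of error coefficients,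
  which has an entry of modulus one.\<close>

lemma innov_var_ge:
  assumes i: "i \<in> {1..n}"
  shows "\<kappa> \<le> innov_cov i i"
proof -
  let ?v = "\<lambda>r. error_coeff i (i - r)"
  have re: "(\<Sum>r\<in>{1..i}. g r) = (\<Sum>l\<le>i - 1. g (i - l))" for g :: "nat \<Rightarrow> real"
    by (rule sum.reindex_bij_witness[of _ "\<lambda>l. i - l" "\<lambda>r. i - r"]) (use i in auto)
  have row: "(\<Sum>s\<in>{1..i}. ?v s * G r s) = - innov_cov r i" if "r \<in> {1..i}" for r
  proof -
    have "(\<Sum>s\<in>{1..i}. ?v s * G r s) = (\<Sum>l\<le>i - 1. error_coeff i l * G r (i - l))"
      unfolding re by (intro sum.cong) (use i in auto)
    then show ?thesis using sum_error_coeff[of i "\<lambda>l. G r (i - l)"] by (simp add: innov_cov_def)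
  qed
  have "\<kappa> * 1 \<le> \<kappa> * (\<Sum>r\<in>{1..i}. (?v r)\<^sup>2)"
  proof (intro mult_left_mono)
    have "(?v i)\<^sup>2 \<le> (\<Sum>r\<in>{1..i}. (?v r)\<^sup>2)" by (intro member_le_sum) (use i in auto)
    then show "1 \<le> (\<Sum>r\<in>{1..i}. (?v r)\<^sup>2)" by (simp add: error_coeff_def)
  qed (use \<kappa> in auto)
  also have "\<dots> \<le> (\<Sum>r\<in>{1..i}. \<Sum>s\<in>{1..i}. ?v r * ?v s * G r s)"
    using i by (intro coercive) auto
  also have "\<dots> = (\<Sum>r\<in>{1..i}. ?v r * (\<Sum>s\<in>{1..i}. ?v s * G r s))"
    by (simp add: sum_distrib_left mult_ac)
  \<comment> \<open>Only \<open>r = i\<close> survives, since the error at time \<open>i\<close> is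
    uncorrelated with earlier entries; there the coefficient \<open>-1\<close> cancels the sign in
    \<open>row\<close>.\<close>
  also have "\<dots> = (\<Sum>r\<in>{1..i}. if r = i then innov_cov i i else 0)"
  proof (intro sum.cong refl)
    fix r assume r: "r \<in> {1..i}"
    show "?v r * (\<Sum>s\<in>{1..i}. ?v s * G r s) = (if r = i then innov_cov i i else 0)"
      unfolding row[OF r] using i r by (auto simp: innov_cov_upper error_coeff_def)
  qed
  also have "\<dots> = innov_cov i i" using i by simp
  finally show ?thesis by simp
qed

definition innov_coeff :: "nat \<Rightarrow> nat \<Rightarrow> real" where
  "innov_coeff i j = innov_cov i j / innov_cov j j"

text \<open>The innovation coefficients are the entries of the inverse of the unit lower triangular
  matrix built from \<^term>\<open>\<phi>\<close>.\<close>

lemma innovation_representation: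
  assumes w: "\<And>i. i \<in> {1..n} \<Longrightarrow> w i = d i - (\<Sum>k = 1..i - 1. \<phi> i k * d (i - k))"
    and "i \<in> {1..n}"
  shows "d i = (\<Sum>j = 1..i. innov_coeff i j * w j)"
  using assms(2)
proof (induction i rule: less_induct)
  case (less i)
  have pos: "innov_cov j j > 0" if "j \<in> {1..n}" for j using innov_var_ge[OF that] \<kappa> by linarith
  \<comment> \<open>Padding all inner sums to the common range up to \<open>i - 1\<close> adds zeros
    only and allows the sums to be exchanged.\<close>
  have ext: "(\<Sum>j = 1..i - k. innov_coeff (i - k) j * w j) = (\<Sum>j = 1..i - 1. innov_coeff (i - k) j * w j)"
    if "k \<in> {1..i - 1}" for k
    using that less.prems by (intro sum.mono_neutral_left) (auto simp: innov_coeff_def innov_cov_upper)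
  have "(\<Sum>k = 1..i - 1. \<phi> i k * d (i - k))
      = (\<Sum>k = 1..i - 1. \<phi> i k * (\<Sum>j = 1..i - 1. innov_coeff (i - k) j * w j))"
  proof (intro sum.cong refl)
    fix k assume k: "k \<in> {1..i - 1}"
    have "d (i - k) = (\<Sum>j = 1..i - k. innov_coeff (i - k) j * w j)"
      using k less.prems by (intro less.IH) auto
    then show "\<phi> i k * d (i - k) = \<phi> i k * (\<Sum>j = 1..i - 1. innov_coeff (i - k) j * w j)"
      using ext[OF k] by simp
  qed
  also have "\<dots> = (\<Sum>j = 1..i - 1. (\<Sum>k = 1..i - 1. \<phi> i k * innov_cov (i - k) j) / innov_cov j j * w j)"
    by (simp add: sum_distrib_left sum_distrib_right sum_divide_distrib innov_coeff_def mult_ac)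
       (rule sum.swap)
  also have "\<dots> = (\<Sum>j = 1..i - 1. innov_coeff i j * w j)"
  proof (intro sum.cong refl)
    fix j assume "j \<in> {1..i - 1}"
    then have "innov_cov i j = (\<Sum>k = 1..i - 1. \<phi> i k * innov_cov (i - k) j)"
      using less.prems by (intro innov_cov_recursion) auto
    then show "(\<Sum>k = 1..i - 1. \<phi> i k * innov_cov (i - k) j) / innov_cov j j * w j = innov_coeff i j * w j"
      by (simp only: innov_coeff_def)
  qed
  finally have "d i = w i + (\<Sum>j = 1..i - 1. innov_coeff i j * w j)" using w[OF less.prems] by simp
  moreover have "{1..i} = insert i {1..i - 1}" using less.prems by auto
  moreover have "innov_coeff i i = 1" using pos[OF less.prems] by (simp add: innov_coeff_def)
  moreover have "i \<notin> {1..i - 1}" using less.prems by auto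
  ultimately show ?case by simp
qed

text \<open>For \<open>j \<le> i\<close> every time \<open>j - k\<close> is at least as far from
  \<open>i\<close> as \<open>j\<close> is, so the kernel at distance \<open>i - j\<close> bounds all
  covariances in \<open>innov_cov i j\<close>. The coefficients contribute the factor
  \<open>A\<close>, the denominator is at least \<open>\<kappa>\<close>, and the kernel is
  summable.\<close>

lemma innov_coeff_row_sum:
  assumes A: "\<And>j. j \<in> {1..n} \<Longrightarrow> 1 + (\<Sum>k = 1..j - 1. \<bar>\<phi> j k\<bar>) \<le> A" and i: "i \<in> {1..n}"
  shows "(\<Sum>j = 1..i. \<bar>innov_coeff i j\<bar>) \<le> C * A / \<kappa> * kernel_sum \<tau>"
proof -
  have "0 \<le> (\<Sum>k = 1..i - 1. \<bar>\<phi> i k\<bar>)" by (rule sum_nonneg) auto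
  then have A0: "A \<ge> 0" using A[OF i] by linarith
  have "\<bar>innov_coeff i j\<bar> \<le> C * A / \<kappa> * (1 + \<bar>real i - real j\<bar>) powr (- \<tau>)" if j: "j \<in> {1..i}" for j
  proof -
    let ?w = "(1 + \<bar>real i - real j\<bar>) powr (- \<tau>)"
    have "\<bar>innov_cov i j\<bar> \<le> \<bar>G i j\<bar> + (\<Sum>k = 1..j - 1. \<bar>\<phi> j k\<bar> * \<bar>G i (j - k)\<bar>)"
      unfolding innov_cov_def abs_mult[symmetric]
      by (rule order_trans[OF abs_triangle_ineq4]) (intro add_left_mono sum_abs)
    also have "\<dots> \<le> C * ?w + (\<Sum>k = 1..j - 1. \<bar>\<phi> j k\<bar> * (C * ?w))"
    proof (intro add_mono sum_mono mult_left_mono)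
      show "\<bar>G i j\<bar> \<le> C * ?w" using i j by (intro decay) auto
      fix k assume k: "k \<in> {1..j - 1}"
      have "\<bar>G i (j - k)\<bar> \<le> C * (1 + \<bar>real i - real (j - k)\<bar>) powr (- \<tau>)"
        using i j k by (intro decay) auto
      also have "\<dots> \<le> C * ?w"
        using i j k C \<tau> by (intro mult_left_mono powr_mono2') (auto simp: of_nat_diff)
      finally show "\<bar>G i (j - k)\<bar> \<le> C * ?w" .
    qed auto
    also have "\<dots> = (1 + (\<Sum>k = 1..j - 1. \<bar>\<phi> j k\<bar>)) * (C * ?w)"
      by (simp add: distrib_right sum_distrib_right)
    also have "\<dots> \<le> A * (C * ?w)" using i j C by (intro mult_right_mono A) auto
    finally have "\<bar>innov_cov i j\<bar> \<le> A * (C * ?w)" .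
    moreover have "\<kappa> \<le> innov_cov j j" using i j by (intro innov_var_ge) auto
    ultimately have "\<bar>innov_cov i j\<bar> / \<bar>innov_cov j j\<bar> \<le> (A * (C * ?w)) / \<kappa>"
      using \<kappa> A0 C by (intro frac_le) auto
    then show ?thesis by (simp add: innov_coeff_def mult_ac)
  qed
  then have "(\<Sum>j = 1..i. \<bar>innov_coeff i j\<bar>) \<le> (\<Sum>j = 1..i. C * A / \<kappa> * (1 + \<bar>real i - real j\<bar>) powr (- \<tau>))"
    by (intro sum_mono)
  also have "\<dots> = C * A / \<kappa> * (\<Sum>j = 1..i. (1 + \<bar>real i - real j\<bar>) powr (- \<tau>))"
    by (simp add: sum_distrib_left)
  also have "\<dots> \<le> C * A / \<kappa> * kernel_sum \<tau>"
    using C A0 \<kappa> by (intro mult_left_mono kernel_row_sum[OF \<tau>, where N = i]) auto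
  finally show ?thesis .
qed

end

subsection \<open>Coercivity of the covariance form\<close>

text \<open>First-order condition at a minimum. Otherwise \<open>t = - p / D\<close> with
  \<open>D = \<bar>q\<bar> + 1\<close> makes the polynomial at most \<open>- p\<^sup>2 / D\<close>,
  which is negative.\<close>

lemma linear_coeff_zero:
  fixes p q :: real
  assumes "\<And>t. 0 \<le> 2 * t * p + t\<^sup>2 * q"
  shows "p = 0"
proof (rule ccontr)
  assume p: "p \<noteq> 0"
  define D where "D = \<bar>q\<bar> + 1"
  have D: "D > 0" "q \<le> D" by (auto simp: D_def)
  have "0 \<le> 2 * (- p / D) * p + (- p / D)\<^sup>2 * q" by (rule assms)
  also have "\<dots> \<le> 2 * (- p / D) * p + (- p / D)\<^sup>2 * D" using D by (intro add_left_mono mult_left_mono) auto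
  also have "\<dots> = - (p\<^sup>2 / D)" using D by (simp add: power2_eq_square)
  finally show False using p D by (simp add: divide_le_0_iff)
qed

text \<open>Vectors are encoded as functions vanishing from \<open>n\<close> on, so the sphere is a
  closed subset of a product of compact sets, compact by Tychonoff.\<close>

lemma compact_unit_sphere_fun:
  "compact {v :: nat \<Rightarrow> real. (\<forall>i\<ge>n. v i = 0) \<and> (\<Sum>i<n. (v i)\<^sup>2) = 1}" (is "compact ?S")
proof -
  let ?B = "PiE UNIV (\<lambda>i. if i < n then {-1..1} else {0}) :: (nat \<Rightarrow> real) set"
  have "compactin (product_topology (\<lambda>_. euclidean) UNIV) ?B"
    unfolding compactin_PiE by (auto simp: compactin_euclidean_iff)
  then have B: "compact ?B" by (simp add: euclidean_product_topology compactin_euclidean_iff)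
  have cont: "continuous_on UNIV (\<lambda>v :: nat \<Rightarrow> real. \<Sum>i<n. (v i)\<^sup>2)"
    by (intro continuous_intros continuous_on_product_coordinates)
  have "closed ((\<lambda>v :: nat \<Rightarrow> real. \<Sum>i<n. (v i)\<^sup>2) -` {1})"
    using continuous_closed_vimage[OF closed_singleton, of "\<lambda>v :: nat \<Rightarrow> real. \<Sum>i<n. (v i)\<^sup>2" 1] cont
    by (simp add: continuous_on_eq_continuous_at)
  with B have "compact (?B \<inter> (\<lambda>v :: nat \<Rightarrow> real. \<Sum>i<n. (v i)\<^sup>2) -` {1})" by (rule compact_Int_closed)
  also have "?B \<inter> (\<lambda>v :: nat \<Rightarrow> real. \<Sum>i<n. (v i)\<^sup>2) -` {1} = ?S"
  proof (intro Set.set_eqI iffI)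
    fix v assume "v \<in> ?S"
    then have v: "\<And>i. i \<ge> n \<Longrightarrow> v i = 0" "(\<Sum>i<n. (v i)\<^sup>2) = 1" by auto
    have "\<bar>v i\<bar> \<le> 1" if "i < n" for i
    proof -
      have "(v i)\<^sup>2 \<le> (\<Sum>i<n. (v i)\<^sup>2)" using that by (intro member_le_sum) auto
      then show ?thesis using v by (simp add: abs_square_le_1)
    qed
    then show "v \<in> ?B \<inter> (\<lambda>v. \<Sum>i<n. (v i)\<^sup>2) -` {1}"
      using v by (auto simp: PiE_iff abs_le_iff)
  qed (auto simp: PiE_iff, metis linorder_not_less singletonD)
  finally show ?thesis .
qed

lemma quadratic_form_perturb:
  fixes G :: "nat \<Rightarrow> nat \<Rightarrow> real"
  assumes sym: "\<And>i j. i < n \<Longrightarrow> j < n \<Longrightarrow> G i j = G j i" and k: "k < n"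
  shows "(\<Sum>i<n. \<Sum>j<n. (u(k := u k + t)) i * (u(k := u k + t)) j * G i j)
    = (\<Sum>i<n. \<Sum>j<n. u i * u j * G i j) + 2 * t * (\<Sum>j<n. G k j * u j) + t\<^sup>2 * G k k"
proof -
  let ?e = "\<lambda>i. if i = k then t else 0"
  have pick: "(\<Sum>i<n. ?e i * g i) = t * g k" for g :: "nat \<Rightarrow> real"
  proof -
    have "(\<Sum>i<n. ?e i * g i) = (\<Sum>i<n. if i = k then t * g k else 0)"
      by (intro sum.cong) auto
    then show ?thesis using k by simp
  qed
  have "(\<Sum>i<n. \<Sum>j<n. (u(k := u k + t)) i * (u(k := u k + t)) j * G i j)
      = (\<Sum>i<n. \<Sum>j<n. u i * u j * G i j + ?e i * (u j * G i j) + ?e j * (u i * G i j) + ?e i * (?e j * G i j))"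
    by (intro sum.cong refl) (auto simp: algebra_simps)
  also have "\<dots> = (\<Sum>i<n. \<Sum>j<n. u i * u j * G i j) + (\<Sum>i<n. ?e i * (\<Sum>j<n. u j * G i j))
      + (\<Sum>i<n. \<Sum>j<n. ?e j * (u i * G i j)) + (\<Sum>i<n. ?e i * (\<Sum>j<n. ?e j * G i j))"
    by (simp only: sum.distrib sum_distrib_left)
  also have "(\<Sum>i<n. ?e i * (\<Sum>j<n. u j * G i j)) = t * (\<Sum>j<n. G k j * u j)"
    unfolding pick by (simp only: mult.commute)
  also have "(\<Sum>i<n. \<Sum>j<n. ?e j * (u i * G i j)) = t * (\<Sum>i<n. u i * G i k)"
    unfolding pick by (simp only: sum_distrib_left)
  also have "(\<Sum>i<n. u i * G i k) = (\<Sum>j<n. G k j * u j)"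
    using k by (intro sum.cong refl) (simp add: sym)
  also have "(\<Sum>i<n. ?e i * (\<Sum>j<n. ?e j * G i j)) = t\<^sup>2 * G k k"
    unfolding pick by (simp add: power2_eq_square)
  finally show ?thesis by simp
qed

text \<open>A minimiser of the quadratic form on the unit sphere is an eigenvector, and the minimum
  is its eigenvalue.\<close>

lemma minimal_eigenvalue_exists:
  fixes G :: "nat \<Rightarrow> nat \<Rightarrow> real"
  assumes sym: "\<And>i j. i < n \<Longrightarrow> j < n \<Longrightarrow> G i j = G j i" and n: "n > 0"
  shows "\<exists>e. eigenvalue (mat n n (\<lambda>(i, j). G i j)) e \<and>
    (\<forall>v. e * (\<Sum>i<n. (v i)\<^sup>2) \<le> (\<Sum>i<n. \<Sum>j<n. v i * v j * G i j))"
proof -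
  let ?S = "{v :: nat \<Rightarrow> real. (\<forall>i\<ge>n. v i = 0) \<and> (\<Sum>i<n. (v i)\<^sup>2) = 1}"
  define Q where "Q v = (\<Sum>i<n. \<Sum>j<n. v i * v j * G i j)" for v
  have "(\<Sum>i<n. (if i = 0 then 1 else 0 :: real)\<^sup>2) = (\<Sum>i<n. if i = 0 then 1 else 0)"
    by (intro sum.cong) auto
  also have "\<dots> = 1" using n by (subst sum.delta) auto
  finally have "(\<lambda>i. if i = 0 then 1 else 0) \<in> ?S" using n by auto
  then have ne: "?S \<noteq> {}" by (metis empty_iff)
  have "continuous_on UNIV Q"
    unfolding Q_def by (intro continuous_intros continuous_on_product_coordinates)
  then have "continuous_on ?S Q" by (rule continuous_on_subset) (rule subset_UNIV)
  with ne obtain u where u: "u \<in> ?S" and min: "\<And>v. v \<in> ?S \<Longrightarrow> Q u \<le> Q v"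
    using continuous_attains_inf[OF compact_unit_sphere_fun, of n Q] by blast
  \<comment> \<open>Homogeneity carries the minimum on the sphere over to all vectors.\<close>
  have bound: "Q u * (\<Sum>i<n. (v i)\<^sup>2) \<le> Q v" for v
  proof (cases "(\<Sum>i<n. (v i)\<^sup>2) = 0")
    case True
    then have "\<forall>i<n. v i = 0" by (simp add: sum_nonneg_eq_0_iff)
    then show ?thesis using True by (simp add: Q_def)
  next
    case False
    define r where "r = sqrt (\<Sum>i<n. (v i)\<^sup>2)"
    have "(\<Sum>i<n. (v i)\<^sup>2) > 0" using False sum_nonneg[of "{..<n}" "\<lambda>i. (v i)\<^sup>2"] by auto
    then have r: "r > 0" "r\<^sup>2 = (\<Sum>i<n. (v i)\<^sup>2)" by (auto simp: r_def)
    let ?v = "\<lambda>i. if i < n then v i / r else 0"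
    have "(\<Sum>i<n. (?v i)\<^sup>2) = (\<Sum>i<n. (v i)\<^sup>2) / r\<^sup>2" by (simp add: power_divide sum_divide_distrib)
    then have "?v \<in> ?S" using r False by auto
    then have "Q u \<le> Q ?v" by (rule min)
    also have "Q ?v = Q v / r\<^sup>2"
      unfolding Q_def by (simp add: sum_divide_distrib power2_eq_square)
    finally have "Q u * r\<^sup>2 \<le> Q v" using r(1) by (subst (asm) pos_le_divide_eq) auto
    then show ?thesis by (simp only: r(2))
  qed
  have eig: "(\<Sum>j<n. G k j * u j) = Q u * u k" if k: "k < n" for k
  proof -
    \<comment> \<open>\<open>bound\<close> is applied to \<open>u\<close> with its
      \<open>k\<close>-th coordinate moved by \<open>t\<close>. The terms constant in
      \<open>t\<close> cancel, so the linear coefficient vanishes, which is the \<open>k\<close>-th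
      eigenvalue equation.\<close>
    have "0 \<le> 2 * t * ((\<Sum>j<n. G k j * u j) - Q u * u k) + t\<^sup>2 * (G k k - Q u)" for t
    proof -
      let ?v = "u(k := u k + t)"
      have "(\<Sum>i<n. (?v i)\<^sup>2) = (\<Sum>i<n. (u i)\<^sup>2 + (if i = k then 2 * t * u k + t\<^sup>2 else 0))"
        by (intro sum.cong) (auto simp: power2_sum)
      also have "\<dots> = 1 + (2 * t * u k + t\<^sup>2)" using u k by (simp add: sum.distrib)
      finally have "Q u * (1 + (2 * t * u k + t\<^sup>2)) \<le> Q ?v" using bound[of ?v] by simp
      moreover have "Q ?v = Q u + 2 * t * (\<Sum>j<n. G k j * u j) + t\<^sup>2 * G k k"
        unfolding Q_def using sym k by (rule quadratic_form_perturb)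
      ultimately show ?thesis by (simp add: algebra_simps)
    qed
    then have "(\<Sum>j<n. G k j * u j) - Q u * u k = 0" by (rule linear_coeff_zero)
    then show ?thesis by simp
  qed
  have "eigenvector (mat n n (\<lambda>(i, j). G i j)) (vec n u) (Q u)"
    unfolding eigenvector_def
  proof (intro conjI)
    show "vec n u \<in> carrier_vec (dim_row (mat n n (\<lambda>(i, j). G i j)))" by simp
    show "vec n u \<noteq> 0\<^sub>v (dim_row (mat n n (\<lambda>(i, j). G i j)))"
    proof
      assume "vec n u = 0\<^sub>v (dim_row (mat n n (\<lambda>(i, j). G i j)))"
      then have "\<forall>i<n. u i = 0" by (auto simp: vec_eq_iff)
      then show False using u by simp
    qed
    show "mat n n (\<lambda>(i, j). G i j) *\<^sub>v vec n u = Q u \<cdot>\<^sub>v vec n u"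
      by (rule eq_vecI) (auto simp: scalar_prod_def eig[symmetric] atLeast0LessThan)
  qed
  then show ?thesis using bound unfolding Q_def eigenvalue_def by blast
qed

text \<open>The spectrum is finite, so \<open>Min\<close> is a genuine minimum and lies below the
  eigenvalue that bounds the form.\<close>

lemma smallest_eigenvalue_le_form:
  fixes G :: "nat \<Rightarrow> nat \<Rightarrow> real"
  assumes sym: "\<And>i j. i < n \<Longrightarrow> j < n \<Longrightarrow> G i j = G j i" and n: "n > 0"
  shows "smallest_eigenvalue (mat n n (\<lambda>(i, j). G i j)) * (\<Sum>i<n. (v i)\<^sup>2)
    \<le> (\<Sum>i<n. \<Sum>j<n. v i * v j * G i j)"
proof -
  let ?A = "mat n n (\<lambda>(i, j). G i j)"
  obtain e where e: "eigenvalue ?A e" "e * (\<Sum>i<n. (v i)\<^sup>2) \<le> (\<Sum>i<n. \<Sum>j<n. v i * v j * G i j)"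
    using minimal_eigenvalue_exists[of n G, OF sym n] by blast
  have "smallest_eigenvalue ?A \<le> e"
    unfolding smallest_eigenvalue_def using e(1) card_finite_spectrum(1)[of ?A n]
    by (intro Min_le) (auto simp: spectrum_def)
  then have "smallest_eigenvalue ?A * (\<Sum>i<n. (v i)\<^sup>2) \<le> e * (\<Sum>i<n. (v i)\<^sup>2)"
    by (intro mult_right_mono sum_nonneg) auto
  with e(2) show ?thesis by linarith
qed

lemma cov_matrix_coercive:
  fixes X :: "nat \<Rightarrow> 'a \<Rightarrow> real"
  assumes "\<kappa> \<le> smallest_eigenvalue (cov_matrix M n X)" and I: "I \<subseteq> {1..n}"
  shows "\<kappa> * (\<Sum>i\<in>I. (v i)\<^sup>2) \<le> (\<Sum>i\<in>I. \<Sum>j\<in>I. v i * v j * covariance M (X i) (X j))"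
proof (cases "n = 0")
  case True
  then show ?thesis using I by simp
next
  case False
  define G where "G i j = covariance M (X (Suc i)) (X (Suc j))" for i j
  \<comment> \<open>Extension by zero outside \<open>I\<close> reduces a principal submatrix to the
    full matrix; \<open>Suc\<close> translates the matrix index into the array index.\<close>
  define w where "w i = (if Suc i \<in> I then v (Suc i) else 0)" for i
  have re: "(\<Sum>i\<in>I. g i) = (\<Sum>i<n. if Suc i \<in> I then g (Suc i) else 0)" for g :: "nat \<Rightarrow> real"
  proof -
    have "(\<Sum>i\<in>I. g i) = (\<Sum>i\<in>{i. i < n \<and> Suc i \<in> I}. g (Suc i))"
    proof (rule sum.reindex_bij_witness[of _ Suc "\<lambda>i. i - 1"])
      fix a assume "a \<in> I"
      then have "1 \<le> a" "a \<le> n" using I by auto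
      then show "Suc (a - 1) = a" "a - 1 \<in> {i. i < n \<and> Suc i \<in> I}" "g (Suc (a - 1)) = g a"
        using \<open>a \<in> I\<close> by auto
    qed auto
    also have "\<dots> = (\<Sum>i | i \<in> {..<n} \<and> Suc i \<in> I. g (Suc i))" by simp
    also have "\<dots> = (\<Sum>i<n. if Suc i \<in> I then g (Suc i) else 0)" by (rule sum.inter_filter) simp
    finally show ?thesis .
  qed
  have "\<kappa> * (\<Sum>i\<in>I. (v i)\<^sup>2) = \<kappa> * (\<Sum>i<n. (w i)\<^sup>2)"
    unfolding re w_def by (intro arg_cong[where f = "(*) \<kappa>"] sum.cong) auto
  also have "\<dots> \<le> smallest_eigenvalue (mat n n (\<lambda>(i, j). G i j)) * (\<Sum>i<n. (w i)\<^sup>2)"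
    using assms(1) by (intro mult_right_mono sum_nonneg) (auto simp: cov_matrix_def G_def)
  also have "\<dots> \<le> (\<Sum>i<n. \<Sum>j<n. w i * w j * G i j)"
    using False by (intro smallest_eigenvalue_le_form) (auto simp: G_def covariance_def mult.commute)
  also have "\<dots> = (\<Sum>i\<in>I. \<Sum>j\<in>I. v i * v j * covariance M (X i) (X j))"
    unfolding re w_def G_def by (auto intro!: sum.cong)
  finally show ?thesis .
qed

subsection \<open>Square integrable variables and the normal equations\<close>

lemma square_integrable_measurable [measurable_dest]: "square_integrable M X \<Longrightarrow> X \<in> borel_measurable M"
  by (simp add: square_integrable_def)

lemma square_integrable_mult:
  assumes X: "square_integrable M X" and Y: "square_integrable M Y"
  shows "integrable M (\<lambda>\<omega>. X \<omega> * Y \<omega>)"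
proof (rule Bochner_Integration.integrable_bound)
  show "integrable M (\<lambda>\<omega>. (X \<omega>)\<^sup>2 + (Y \<omega>)\<^sup>2)"
    using X Y by (auto simp: square_integrable_def)
  show "(\<lambda>\<omega>. X \<omega> * Y \<omega>) \<in> borel_measurable M" using X Y by measurable
  have "\<bar>x * y\<bar> \<le> x\<^sup>2 + y\<^sup>2" for x y :: real
    using sum_squares_bound[of "\<bar>x\<bar>" "\<bar>y\<bar>"] mult_nonneg_nonneg[OF abs_ge_zero abs_ge_zero, of x y]
    unfolding abs_mult power2_abs by linarith
  then show "AE \<omega> in M. norm (X \<omega> * Y \<omega>) \<le> norm ((X \<omega>)\<^sup>2 + (Y \<omega>)\<^sup>2)" by auto
qed

lemma square_integrable_add:
  assumes X: "square_integrable M X" and Y: "square_integrable M Y"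
  shows "square_integrable M (\<lambda>\<omega>. X \<omega> + Y \<omega>)"
  unfolding square_integrable_def power2_sum
  using X Y square_integrable_mult[OF X Y] by (auto simp: square_integrable_def mult.assoc)

lemma square_integrable_cmult: "square_integrable M X \<Longrightarrow> square_integrable M (\<lambda>\<omega>. c * X \<omega>)"
  by (auto simp: square_integrable_def power_mult_distrib)

lemma square_integrable_diff:
  "square_integrable M X \<Longrightarrow> square_integrable M Y \<Longrightarrow> square_integrable M (\<lambda>\<omega>. X \<omega> - Y \<omega>)"
  using square_integrable_add[of M X "\<lambda>\<omega>. (- 1) * Y \<omega>"] square_integrable_cmult[of M Y "- 1"] by simp

lemma square_integrable_zero: "square_integrable M (\<lambda>\<omega>. 0)"
  by (simp add: square_integrable_def)

lemma square_integrable_const: "prob_space M \<Longrightarrow> square_integrable M (\<lambda>\<omega>. c)"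
  by (simp add: square_integrable_def finite_measure.integrable_const prob_space.finite_measure)

lemma square_integrable_sum:
  "(\<And>j. j \<in> J \<Longrightarrow> square_integrable M (X j)) \<Longrightarrow> square_integrable M (\<lambda>\<omega>. \<Sum>j\<in>J. X j \<omega>)"
  by (induction J rule: infinite_finite_induct)
     (auto intro: square_integrable_add square_integrable_zero)

lemma square_integrable_integrable:
  assumes "prob_space M" "square_integrable M X"
  shows "integrable M X"
  using square_integrable_mult[OF assms(2) square_integrable_const[OF assms(1), of 1]] by simp

lemma square_integrable_linear_pred:
  assumes "prob_space M" and "\<And>j. j \<in> {1..m} \<Longrightarrow> square_integrable M (X (i - j))"
  shows "square_integrable M (linear_pred m c X i)"
proof -
  have "square_integrable M (\<lambda>\<omega>. c 0 + (\<Sum>j = 1..m. c j * X (i - j) \<omega>))"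
    using assms by (intro square_integrable_add square_integrable_const square_integrable_sum square_integrable_cmult)
  then show ?thesis by (simp add: linear_pred_def[abs_def])
qed

text \<open>The triangle inequality in \<open>L2\<close> for arbitrarily dependent, possibly
  uncentred variables, via Cauchy-Schwarz with each weight \<open>\<bar>c j\<bar>\<close> split into
  two square roots.\<close>

lemma integral_square_sum_le:
  assumes X: "\<And>j. j \<in> J \<Longrightarrow> square_integrable M (X j)"
    and S: "\<And>j. j \<in> J \<Longrightarrow> (\<integral>\<omega>. (X j \<omega>)\<^sup>2 \<partial>M) \<le> S"
  shows "(\<integral>\<omega>. (\<Sum>j\<in>J. c j * X j \<omega>)\<^sup>2 \<partial>M) \<le> (\<Sum>j\<in>J. \<bar>c j\<bar>)\<^sup>2 * S"
proof -
  let ?A = "\<Sum>j\<in>J. \<bar>c j\<bar>"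
  have A: "?A \<ge> 0" by (rule sum_nonneg) auto
  have "(\<Sum>j\<in>J. c j * X j \<omega>)\<^sup>2 \<le> ?A * (\<Sum>j\<in>J. \<bar>c j\<bar> * (X j \<omega>)\<^sup>2)" for \<omega>
  proof -
    have "\<bar>\<Sum>j\<in>J. c j * X j \<omega>\<bar> \<le> (\<Sum>j\<in>J. sqrt \<bar>c j\<bar> * (sqrt \<bar>c j\<bar> * \<bar>X j \<omega>\<bar>))"
      by (rule order_trans[OF sum_abs]) (simp add: abs_mult mult.assoc[symmetric])
    then have "(\<Sum>j\<in>J. c j * X j \<omega>)\<^sup>2 \<le> (\<Sum>j\<in>J. sqrt \<bar>c j\<bar> * (sqrt \<bar>c j\<bar> * \<bar>X j \<omega>\<bar>))\<^sup>2"
      by (rule power2_le_iff_abs_le[THEN iffD2, rotated]) (auto intro: sum_nonneg)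
    also have "\<dots> \<le> (\<Sum>j\<in>J. (sqrt \<bar>c j\<bar>)\<^sup>2) * (\<Sum>j\<in>J. (sqrt \<bar>c j\<bar> * \<bar>X j \<omega>\<bar>)\<^sup>2)"
      by (rule Cauchy_Schwarz_ineq_sum)
    finally show ?thesis by (simp add: power_mult_distrib)
  qed
  moreover have "integrable M (\<lambda>\<omega>. (\<Sum>j\<in>J. c j * X j \<omega>)\<^sup>2)"
    using square_integrable_sum[of J M "\<lambda>j \<omega>. c j * X j \<omega>"] X square_integrable_cmult
    by (auto simp: square_integrable_def)
  moreover have int: "integrable M (\<lambda>\<omega>. \<Sum>j\<in>J. \<bar>c j\<bar> * (X j \<omega>)\<^sup>2)"
    using X by (auto simp: square_integrable_def)
  ultimately have "(\<integral>\<omega>. (\<Sum>j\<in>J. c j * X j \<omega>)\<^sup>2 \<partial>M) \<le> (\<integral>\<omega>. ?A * (\<Sum>j\<in>J. \<bar>c j\<bar> * (X j \<omega>)\<^sup>2) \<partial>M)"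
    by (intro integral_mono) auto
  also have "\<dots> = ?A * (\<Sum>j\<in>J. \<bar>c j\<bar> * (\<integral>\<omega>. (X j \<omega>)\<^sup>2 \<partial>M))"
    using X by (simp add: square_integrable_def Bochner_Integration.integral_sum)
  also have "\<dots> \<le> ?A * (\<Sum>j\<in>J. \<bar>c j\<bar> * S)"
    using A S by (intro mult_left_mono sum_mono) auto
  also have "\<dots> = ?A\<^sup>2 * S" by (simp add: sum_distrib_right[symmetric] power2_eq_square)
  finally show ?thesis .
qed

lemma integral_square_diff_le:
  assumes X: "square_integrable M X" and Y: "square_integrable M Y"
  shows "(\<integral>\<omega>. (X \<omega> - Y \<omega>)\<^sup>2 \<partial>M) \<le> 2 * (\<integral>\<omega>. (X \<omega>)\<^sup>2 \<partial>M) + 2 * (\<integral>\<omega>. (Y \<omega>)\<^sup>2 \<partial>M)"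
proof -
  have le: "(x - y)\<^sup>2 \<le> 2 * x\<^sup>2 + 2 * y\<^sup>2" for x y :: real
    using zero_le_power2[of "x + y"] by (simp add: power2_sum power2_diff)
  have "(\<integral>\<omega>. (X \<omega> - Y \<omega>)\<^sup>2 \<partial>M) \<le> (\<integral>\<omega>. 2 * (X \<omega>)\<^sup>2 + 2 * (Y \<omega>)\<^sup>2 \<partial>M)"
    using X Y square_integrable_diff[OF X Y] le
    by (intro integral_mono) (auto simp: square_integrable_def)
  also have "\<dots> = 2 * (\<integral>\<omega>. (X \<omega>)\<^sup>2 \<partial>M) + 2 * (\<integral>\<omega>. (Y \<omega>)\<^sup>2 \<partial>M)"
    using X Y by (simp add: square_integrable_def)
  finally show ?thesis .
qed

lemma second_moment:
  assumes M: "prob_space M" and X: "square_integrable M X"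
  shows "(\<integral>\<omega>. (X \<omega>)\<^sup>2 \<partial>M) = prob_space.variance M X + (\<integral>\<omega>. X \<omega> \<partial>M)\<^sup>2"
  using prob_space.variance_eq[OF M square_integrable_integrable[OF M X]] X
  by (simp add: square_integrable_def)

lemma minimiser_orthogonal:
  assumes e: "square_integrable M e" and Z: "square_integrable M Z"
    and min: "\<And>t. (\<integral>\<omega>. (e \<omega>)\<^sup>2 \<partial>M) \<le> (\<integral>\<omega>. (e \<omega> - t * Z \<omega>)\<^sup>2 \<partial>M)"
  shows "(\<integral>\<omega>. e \<omega> * Z \<omega> \<partial>M) = 0"
proof -
  have "0 \<le> 2 * t * (\<integral>\<omega>. e \<omega> * Z \<omega> \<partial>M) + t\<^sup>2 * (\<integral>\<omega>. (Z \<omega>)\<^sup>2 \<partial>M)" for t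
  proof -
    have "(e \<omega> - (- t) * Z \<omega>)\<^sup>2 = (e \<omega>)\<^sup>2 + (2 * t * (e \<omega> * Z \<omega>) + t\<^sup>2 * (Z \<omega>)\<^sup>2)" for \<omega>
      by (simp add: power2_sum power_mult_distrib)
    then have "(\<integral>\<omega>. (e \<omega> - (- t) * Z \<omega>)\<^sup>2 \<partial>M)
        = (\<integral>\<omega>. (e \<omega>)\<^sup>2 \<partial>M) + (2 * t * (\<integral>\<omega>. e \<omega> * Z \<omega> \<partial>M) + t\<^sup>2 * (\<integral>\<omega>. (Z \<omega>)\<^sup>2 \<partial>M))"
      using e Z square_integrable_mult[OF e Z] by (simp add: square_integrable_def)
    with min[of "- t"] show ?thesis by linarith
  qed
  then show ?thesis by (rule linear_coeff_zero)
qed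

text \<open>Perturbing the intercept shows that the error has mean zero, and perturbing
  \<open>c l\<close> shows that it is orthogonal to \<open>X (i - l)\<close>. Together they make the
  error uncorrelated with \<open>X (i - l)\<close>.\<close>

lemma best_linear_pred_normal_equations:
  assumes M: "prob_space M" and i: "1 \<le> i"
    and X: "\<And>j. j \<in> {1..i} \<Longrightarrow> square_integrable M (X j)"
    and best: "best_linear_pred_coeffs M X i c"
    and l: "l \<in> {1..i - 1}"
  shows "covariance M (X i) (X (i - l)) = (\<Sum>j = 1..i - 1. c j * covariance M (X (i - j)) (X (i - l)))"
proof -
  interpret prob_space M by fact
  define e where "e \<omega> = X i \<omega> - linear_pred (i - 1) c X i \<omega>" for \<omega>
  define \<mu> where "\<mu> j = (\<integral>\<omega>. X j \<omega> \<partial>M)" for j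
  define Y where "Y j \<omega> = X j \<omega> - \<mu> j" for j \<omega>
  have e: "square_integrable M e"
    unfolding e_def using M X i by (intro square_integrable_diff square_integrable_linear_pred) auto
  have Y: "square_integrable M (Y j)" if "j \<in> {1..i}" for j
    unfolding Y_def using X[OF that] M by (intro square_integrable_diff square_integrable_const) auto
  have orth: "(\<integral>\<omega>. e \<omega> * Z \<omega> \<partial>M) = 0"
    if Z: "square_integrable M Z"
      and pert: "\<And>t \<omega>. linear_pred (i - 1) (c(k := c k + t)) X i \<omega> = linear_pred (i - 1) c X i \<omega> + t * Z \<omega>"
    for Z k
  proof (rule minimiser_orthogonal[OF e Z])
    fix t
    have "(\<integral>\<omega>. (e \<omega>)\<^sup>2 \<partial>M) \<le> (\<integral>\<omega>. (X i \<omega> - linear_pred (i - 1) (c(k := c k + t)) X i \<omega>)\<^sup>2 \<partial>M)"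
      using best unfolding best_linear_pred_coeffs_def e_def by blast
    also have "\<dots> = (\<integral>\<omega>. (e \<omega> - t * Z \<omega>)\<^sup>2 \<partial>M)"
      unfolding pert e_def by (simp add: algebra_simps)
    finally show "(\<integral>\<omega>. (e \<omega>)\<^sup>2 \<partial>M) \<le> (\<integral>\<omega>. (e \<omega> - t * Z \<omega>)\<^sup>2 \<partial>M)" .
  qed
  have "(\<integral>\<omega>. e \<omega> * 1 \<partial>M) = 0"
  proof (rule orth[of _ 0])
    fix t \<omega>
    have "(\<Sum>j = 1..i - 1. (c(0 := c 0 + t)) j * X (i - j) \<omega>) = (\<Sum>j = 1..i - 1. c j * X (i - j) \<omega>)"
      by (intro sum.cong) auto
    then show "linear_pred (i - 1) (c(0 := c 0 + t)) X i \<omega> = linear_pred (i - 1) c X i \<omega> + t * 1"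
      by (simp add: linear_pred_def)
  qed (intro square_integrable_const M)
  then have e0: "(\<integral>\<omega>. e \<omega> \<partial>M) = 0" by simp
  have el: "(\<integral>\<omega>. e \<omega> * X (i - l) \<omega> \<partial>M) = 0"
  proof (rule orth[of _ l])
    fix t \<omega>
    have "(\<Sum>j = 1..i - 1. (c(l := c l + t)) j * X (i - j) \<omega>)
        = (\<Sum>j = 1..i - 1. c j * X (i - j) \<omega> + (if j = l then t * X (i - l) \<omega> else 0))"
      by (intro sum.cong) (auto simp: algebra_simps)
    also have "\<dots> = (\<Sum>j = 1..i - 1. c j * X (i - j) \<omega>) + t * X (i - l) \<omega>"
      using l by (simp add: sum.distrib)
    finally show "linear_pred (i - 1) (c(l := c l + t)) X i \<omega> = linear_pred (i - 1) c X i \<omega> + t * X (i - l) \<omega>"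
      using l by (simp add: linear_pred_def)
  qed (use l X in auto)
  note int = square_integrable_integrable[OF M]
  \<comment> \<open>Collects the intercept and all means; its contribution vanishes because it
    multiplies the mean of a centred variable.\<close>
  define r where "r = \<mu> i - c 0 - (\<Sum>j = 1..i - 1. c j * \<mu> (i - j))"
  have e_eq: "e \<omega> = Y i \<omega> - (\<Sum>j = 1..i - 1. c j * Y (i - j) \<omega>) + r" for \<omega>
    by (simp add: e_def linear_pred_def Y_def r_def right_diff_distrib sum_subtractf)
  have Y0: "(\<integral>\<omega>. Y j \<omega> \<partial>M) = 0" if "j \<in> {1..i}" for j
    using int[OF X[OF that]] by (simp add: Y_def \<mu>_def prob_space)
  have Ysum: "square_integrable M (\<lambda>\<omega>. \<Sum>j = 1..i - 1. c j * Y (i - j) \<omega>)"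
    using i by (intro square_integrable_sum square_integrable_cmult Y) auto
  have "(\<integral>\<omega>. e \<omega> * (Y (i - l) \<omega>) \<partial>M) = (\<integral>\<omega>. e \<omega> * X (i - l) \<omega> - \<mu> (i - l) * e \<omega> \<partial>M)"
    by (simp add: Y_def algebra_simps)
  also have "\<dots> = 0"
  proof -
    have "integrable M (\<lambda>\<omega>. e \<omega> * X (i - l) \<omega>)"
      using l by (intro square_integrable_mult[OF e X]) auto
    then show ?thesis using int[OF e] e0 el by simp
  qed
  finally have eY: "(\<integral>\<omega>. e \<omega> * (Y (i - l) \<omega>) \<partial>M) = 0" .
  have il: "i - l \<in> {1..i}" using l by auto
  have prod: "integrable M (\<lambda>\<omega>. Y j \<omega> * Y (i - l) \<omega>)" if "j \<in> {1..i}" for j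
    by (rule square_integrable_mult[OF Y[OF that] Y[OF il]])
  have "e \<omega> * Y (i - l) \<omega> = Y i \<omega> * Y (i - l) \<omega>
      - (\<Sum>j = 1..i - 1. c j * (Y (i - j) \<omega> * Y (i - l) \<omega>)) + r * Y (i - l) \<omega>" for \<omega>
    by (simp add: e_eq algebra_simps sum_distrib_left)
  then have "0 = (\<integral>\<omega>. Y i \<omega> * Y (i - l) \<omega>
      - (\<Sum>j = 1..i - 1. c j * (Y (i - j) \<omega> * Y (i - l) \<omega>)) + r * Y (i - l) \<omega> \<partial>M)"
    using eY by simp
  also have "\<dots> = (\<integral>\<omega>. Y i \<omega> * Y (i - l) \<omega> \<partial>M)
      - (\<integral>\<omega>. (\<Sum>j = 1..i - 1. c j * (Y (i - j) \<omega> * Y (i - l) \<omega>)) \<partial>M) + r * (\<integral>\<omega>. Y (i - l) \<omega> \<partial>M)"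
  proof -
    have 1: "integrable M (\<lambda>\<omega>. Y i \<omega> * Y (i - l) \<omega>)" using i by (intro prod) auto
    have 2: "integrable M (\<lambda>\<omega>. \<Sum>j = 1..i - 1. c j * (Y (i - j) \<omega> * Y (i - l) \<omega>))"
      using i by (intro Bochner_Integration.integrable_sum integrable_mult_right prod) auto
    show ?thesis using 1 2 int[OF Y[OF il]] by simp
  qed
  also have "(\<integral>\<omega>. (\<Sum>j = 1..i - 1. c j * (Y (i - j) \<omega> * Y (i - l) \<omega>)) \<partial>M)
      = (\<Sum>j = 1..i - 1. c j * (\<integral>\<omega>. Y (i - j) \<omega> * Y (i - l) \<omega> \<partial>M))"
    using i by (subst Bochner_Integration.integral_sum) (auto intro!: integrable_mult_right prod)
  finally show ?thesis using Y0[OF il] by (simp add: covariance_def Y_def \<mu>_def)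
qed

section \<open>The AR process and its defect in the full recursion\<close>

lemma square_integrable_ar_process:
  assumes M: "prob_space M" and X: "\<And>j. j \<in> {1..n} \<Longrightarrow> square_integrable M (X j)" and "i \<in> {1..n}"
  shows "square_integrable M (ar_process b \<phi> X i)"
  using assms(3)
proof (induction i rule: less_induct)
  case (less i)
  show ?case
  proof (cases "i \<le> b")
    case True
    then have "ar_process b \<phi> X i = X i" by (auto simp: ar_process.simps[of b \<phi> X i])
    then show ?thesis using X less.prems by simp
  next
    case False
    have eq: "ar_process b \<phi> X i = (\<lambda>\<omega>. (\<phi> i 0 + (\<Sum>j = 1..b. \<phi> i j * ar_process b \<phi> X (i - j) \<omega>))
        + (X i \<omega> - linear_pred (i - 1) (\<phi> i) X i \<omega>))"
      using False by (auto simp: ar_process.simps[of b \<phi> X i] prediction_error_def)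
    show ?thesis
      unfolding eq using False less.prems
      by (intro square_integrable_add square_integrable_diff square_integrable_const square_integrable_sum
          square_integrable_cmult square_integrable_linear_pred M X less.IH) auto
  qed
qed

text \<open>The full predictor and the prediction error sum to the entry exactly, so only the
  omitted lags remain.\<close>

lemma truncation_error:
  assumes "1 \<le> i"
  shows "X i \<omega> - (linear_pred (min b (i - 1)) (\<phi> i) X i \<omega> + prediction_error \<phi> X i \<omega>)
    = (\<Sum>j\<in>{b<..i - 1}. \<phi> i j * X (i - j) \<omega>)"
proof -
  have "{1..i - 1} = {1..min b (i - 1)} \<union> {b<..i - 1}" by auto
  then have "(\<Sum>j = 1..i - 1. \<phi> i j * X (i - j) \<omega>)
      = (\<Sum>j = 1..min b (i - 1). \<phi> i j * X (i - j) \<omega>) + (\<Sum>j\<in>{b<..i - 1}. \<phi> i j * X (i - j) \<omega>)"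
    by (simp only:) (rule sum.union_disjoint, auto)
  then show ?thesis by (simp add: prediction_error_def linear_pred_def)
qed

text \<open>The intercept and the prediction error occur in both recursions and cancel; what the AR
  recursion omits are the lags beyond \<open>b\<close>, evaluated at the AR process itself.\<close>

lemma ar_process_defect:
  defines "d \<equiv> \<lambda>b \<phi> X i \<omega>. X i \<omega> - ar_process b \<phi> X i \<omega>"
  assumes "1 \<le> i"
  shows "d b \<phi> X i \<omega> - (\<Sum>k = 1..i - 1. \<phi> i k * d b \<phi> X (i - k) \<omega>)
    = (\<Sum>k\<in>{b<..i - 1}. \<phi> i k * ar_process b \<phi> X (i - k) \<omega>)"
proof (cases "i \<le> b")
  case True
  \<comment> \<open>Both sides are zero here: the two processes agree up to time \<open>b\<close>,
    and the right-hand sum is empty.\<close>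
  then have "i - k \<le> b" for k by linarith
  then have "ar_process b \<phi> X (i - k) \<omega> = X (i - k) \<omega>" for k
    by (simp add: ar_process.simps[of b \<phi> X "i - k"])
  from this this[of 0] show ?thesis using True by (simp add: d_def)
next
  case False
  then have un: "{1..i - 1} = {1..b} \<union> {b<..i - 1}" by auto
  have split: "(\<Sum>k = 1..i - 1. g k) = (\<Sum>k = 1..b. g k) + (\<Sum>k\<in>{b<..i - 1}. g k)" for g :: "nat \<Rightarrow> real"
    unfolding un by (rule sum.union_disjoint) auto
  show ?thesis
    using False unfolding d_def ar_process.simps[of b \<phi> X i] prediction_error_def linear_pred_def split
    by (simp add: right_diff_distrib sum_subtractf)
qed

subsection \<open>Uniform bounds along the array\<close>

text \<open>The finitely many early rows contain finitely many entries; as the rate is positive,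
  their ratios to it are absorbed into the constant.\<close>

lemma O_l2I:
  assumes sq: "\<And>n i. n \<in> N \<Longrightarrow> i \<in> {1..n} \<Longrightarrow> square_integrable (M n) (y n i)"
    and pos: "\<And>n. n \<in> N \<Longrightarrow> a n > 0"
    and ev: "\<forall>\<^sub>F n in sequentially. n \<in> N \<longrightarrow> (\<forall>i\<in>{1..n}. sqrt (\<integral>\<omega>. (y n i \<omega>)\<^sup>2 \<partial>M n) \<le> C * a n)"
  shows "O_l2 N M y a"
proof -
  obtain n0 where n0: "\<And>n i. n \<ge> n0 \<Longrightarrow> n \<in> N \<Longrightarrow> i \<in> {1..n} \<Longrightarrow> sqrt (\<integral>\<omega>. (y n i \<omega>)\<^sup>2 \<partial>M n) \<le> C * a n"
    using ev unfolding eventually_at_top_linorder by blast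
  define f where "f = (\<lambda>(n, i). sqrt (\<integral>\<omega>. (y n i \<omega>)\<^sup>2 \<partial>M n) / a n)"
  define D where "D = Max (insert C (f ` (SIGMA n:{..<n0}. {1..n})))"
  have "sqrt (\<integral>\<omega>. (y n i \<omega>)\<^sup>2 \<partial>M n) \<le> D * a n" if n: "n \<in> N" and i: "i \<in> {1..n}" for n i
  proof (cases "n < n0")
    case True
    then have "f (n, i) \<le> D" unfolding D_def using i by (intro Max_ge) auto
    then show ?thesis using pos[OF n] by (simp add: f_def divide_le_eq)
  next
    case False
    have "C \<le> D" unfolding D_def by (intro Max_ge) auto
    then have "C * a n \<le> D * a n" using pos[OF n] by (intro mult_right_mono) auto
    with n0[OF _ n i] False show ?thesis by simp
  qed
  then show ?thesis using sq by (auto simp: O_l2_def intro!: exI[of _ D])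
qed

text \<open>For \<open>b \<ge> 2\<close> the logarithmic factor is at least
  \<open>ln 2 powr (\<tau> - 1)\<close>, so a pure power suffices.\<close>

lemma powr_le_ar_rate:
  assumes "\<tau> > 1" "\<tau> - 3 / 2 \<le> \<beta>" "2 \<le> b"
  shows "real b powr (- \<beta>) \<le> inverse (ln 2 powr (\<tau> - 1)) * ar_rate \<tau> b"
proof -
  have l: "(0::real) < ln 2 powr (\<tau> - 1)" by simp
  have "ln 2 powr (\<tau> - 1) * real b powr (- \<beta>) \<le> ln (real b) powr (\<tau> - 1) * real b powr (- (\<tau> - 1.5))"
    using assms by (intro mult_mono powr_mono2 powr_mono) auto
  then show ?thesis using l by (simp add: ar_rate_def field_simps)
qed

lemma ar_rate_pos: "2 \<le> b \<Longrightarrow> ar_rate \<tau> b > 0"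
  by (simp add: ar_rate_def)

text \<open>Merges the diagonal, bounded by the variance, with the off-diagonal decay. For distance
  \<open>d \<ge> 1\<close>, replacing \<open>d\<close> by \<open>1 + d\<close> costs the factor
  \<open>2 powr \<tau>\<close>.\<close>

lemma short_range_dependent_kernel:
  assumes "\<tau> > 1" "short_range_dependent \<tau> M x"
  shows "\<exists>C>0. \<forall>n. \<forall>i\<in>{1..n}. \<forall>j\<in>{1..n}.
    \<bar>covariance (M n) (x n i) (x n j)\<bar> \<le> C * (1 + \<bar>real i - real j\<bar>) powr (- \<tau>)"
proof -
  obtain C V where C: "C > 0" and V: "\<And>n i. i \<in> {1..n} \<Longrightarrow> prob_space.variance (M n) (x n i) \<le> V"
    and decay: "\<And>n k r. k \<in> {1..n} \<Longrightarrow> r \<in> {- int k + 1..int n - int k} \<Longrightarrow> r \<noteq> 0 \<Longrightarrow>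
        \<bar>covariance (M n) (x n k) (x n (nat (int k + r)))\<bar> \<le> C * real_of_int \<bar>r\<bar> powr (- \<tau>)"
    using assms(2) unfolding short_range_dependent_def by metis
  have "\<bar>covariance (M n) (x n i) (x n j)\<bar> \<le> (C * 2 powr \<tau> + \<bar>V\<bar>) * (1 + \<bar>real i - real j\<bar>) powr (- \<tau>)"
    if i: "i \<in> {1..n}" and j: "j \<in> {1..n}" for n i j
  proof (cases "i = j")
    case True
    have "covariance (M n) (x n i) (x n i) = prob_space.variance (M n) (x n i)"
      by (simp add: covariance_def power2_eq_square)
    moreover have "covariance (M n) (x n i) (x n i) \<ge> 0" by (simp add: covariance_def)
    ultimately show ?thesis using V[OF i] True C by (simp add: add_increasing)
  next
    case False
    define r where "r = int j - int i"
    let ?d = "\<bar>real i - real j\<bar>"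
    have r: "real_of_int \<bar>r\<bar> = ?d" "nat (int i + r) = j" by (auto simp: r_def)
    have "\<bar>r\<bar> \<ge> 1" using False by (auto simp: r_def)
    then have d: "?d \<ge> 1" unfolding r(1)[symmetric] by linarith
    have "\<bar>covariance (M n) (x n i) (x n j)\<bar> \<le> C * ?d powr (- \<tau>)"
      using decay[of i n r] i j False unfolding r by (auto simp: r_def)
    also have "?d powr (- \<tau>) \<le> ((1 + ?d) / 2) powr (- \<tau>)"
      using d assms(1) by (intro powr_mono2') auto
    also have "\<dots> = (1 + ?d) powr (- \<tau>) * 2 powr \<tau>"
      by (simp add: powr_divide powr_minus field_simps)
    finally have "\<bar>covariance (M n) (x n i) (x n j)\<bar> \<le> C * ((1 + ?d) powr (- \<tau>) * 2 powr \<tau>)"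
      using C by simp
    also have "\<dots> \<le> (C * 2 powr \<tau> + \<bar>V\<bar>) * (1 + ?d) powr (- \<tau>)" by (simp add: algebra_simps)
    finally show ?thesis .
  qed
  moreover have "C * 2 powr \<tau> + \<bar>V\<bar> > 0" using C by (intro add_pos_nonneg) auto
  ultimately show ?thesis by blast
qed

lemma short_range_dependent_second_moment:
  assumes "triangular_array M x" "short_range_dependent \<tau> M x"
  shows "\<exists>S\<ge>0. \<forall>n. \<forall>i\<in>{1..n}. (\<integral>\<omega>. (x n i \<omega>)\<^sup>2 \<partial>M n) \<le> S"
proof -
  obtain V B where V: "\<And>n i. i \<in> {1..n} \<Longrightarrow> prob_space.variance (M n) (x n i) \<le> V"
    and B: "\<And>n i. i \<in> {1..n} \<Longrightarrow> prob_space.expectation (M n) (\<lambda>\<omega>. \<bar>x n i \<omega>\<bar>) \<le> B"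
    using assms(2) unfolding short_range_dependent_def by metis
  have "(\<integral>\<omega>. (x n i \<omega>)\<^sup>2 \<partial>M n) \<le> \<bar>V\<bar> + B\<^sup>2" if i: "i \<in> {1..n}" for n i
  proof -
    have M: "prob_space (M n)" and X: "square_integrable (M n) (x n i)"
      using assms(1) i by (auto simp: triangular_array_def)
    have "\<bar>\<integral>\<omega>. x n i \<omega> \<partial>M n\<bar> \<le> B" by (rule order_trans[OF integral_abs_bound B[OF i]])
    then have "(\<integral>\<omega>. x n i \<omega> \<partial>M n)\<^sup>2 \<le> B\<^sup>2" using abs_le_square_iff[of _ B] by fastforce
    then show ?thesis unfolding second_moment[OF M X] using V[OF i] by linarith
  qed
  then show ?thesis by (intro exI[of _ "\<bar>V\<bar> + B\<^sup>2"]) auto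
qed

text \<open>A self-bounding argument for the largest mean square error \<open>\<Delta>\<close> of
  the row: the AR process has second moments at most \<open>2 * S + 2 * \<Delta>\<close>, which
  bounds the defect and, through the innovation coefficients, \<open>\<Delta>\<close>
  itself.\<close>

lemma ar_error_bound:
  fixes X :: "nat \<Rightarrow> 'a \<Rightarrow> real"
  assumes M: "prob_space M" and X: "\<And>i. i \<in> {1..n} \<Longrightarrow> square_integrable M (X i)"
    and S: "\<And>i. i \<in> {1..n} \<Longrightarrow> (\<integral>\<omega>. (X i \<omega>)\<^sup>2 \<partial>M) \<le> S"
    and kernel: "prediction_kernel \<kappa> C \<tau> n G \<phi>"
    and A: "\<And>i. i \<in> {1..n} \<Longrightarrow> 1 + (\<Sum>k = 1..i - 1. \<bar>\<phi> i k\<bar>) \<le> A"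
    and \<rho>: "\<And>i. i \<in> {1..n} \<Longrightarrow> (\<Sum>k\<in>{b<..i - 1}. \<bar>\<phi> i k\<bar>) \<le> \<rho>"
    and small: "4 * (C * A / \<kappa> * kernel_sum \<tau>)\<^sup>2 * \<rho>\<^sup>2 \<le> 1"
    and i: "i \<in> {1..n}"
  shows "(\<integral>\<omega>. (X i \<omega> - ar_process b \<phi> X i \<omega>)\<^sup>2 \<partial>M) \<le> 4 * (C * A / \<kappa> * kernel_sum \<tau>)\<^sup>2 * \<rho>\<^sup>2 * S"
proof -
  interpret prediction_kernel \<kappa> C \<tau> n G \<phi> by fact
  define \<Lambda> where "\<Lambda> = C * A / \<kappa> * kernel_sum \<tau>"
  define d where "d i \<omega> = X i \<omega> - ar_process b \<phi> X i \<omega>" for i \<omega>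
  define w where "w i \<omega> = (\<Sum>k\<in>{b<..i - 1}. \<phi> i k * ar_process b \<phi> X (i - k) \<omega>)" for i \<omega>
  \<comment> \<open>A maximum over finitely many reals, hence finite and subtractable.\<close>
  define \<Delta> where "\<Delta> = Max ((\<lambda>i. \<integral>\<omega>. (d i \<omega>)\<^sup>2 \<partial>M) ` {1..n})"
  have \<Delta>: "(\<integral>\<omega>. (d i \<omega>)\<^sup>2 \<partial>M) \<le> \<Delta>" if "i \<in> {1..n}" for i
    unfolding \<Delta>_def using that by (intro Max_ge) auto
  have ar: "square_integrable M (ar_process b \<phi> X i)" if "i \<in> {1..n}" for i
    using square_integrable_ar_process[OF M X that] by simp
  have d: "square_integrable M (d i)" if "i \<in> {1..n}" for i
    unfolding d_def by (intro square_integrable_diff X ar that)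
  have ar2: "(\<integral>\<omega>. (ar_process b \<phi> X i \<omega>)\<^sup>2 \<partial>M) \<le> 2 * S + 2 * \<Delta>" if "i \<in> {1..n}" for i
  proof -
    have "(\<integral>\<omega>. (ar_process b \<phi> X i \<omega>)\<^sup>2 \<partial>M) = (\<integral>\<omega>. (X i \<omega> - d i \<omega>)\<^sup>2 \<partial>M)" by (simp add: d_def)
    also have "\<dots> \<le> 2 * (\<integral>\<omega>. (X i \<omega>)\<^sup>2 \<partial>M) + 2 * (\<integral>\<omega>. (d i \<omega>)\<^sup>2 \<partial>M)"
      by (intro integral_square_diff_le X d that)
    also have "\<dots> \<le> 2 * S + 2 * \<Delta>" using S[OF that] \<Delta>[OF that] by linarith
    finally show ?thesis .
  qed
  have w_sq: "square_integrable M (w i)" if "i \<in> {1..n}" for i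
    unfolding w_def using that by (intro square_integrable_sum square_integrable_cmult ar) auto
  have nn: "0 \<le> 2 * S + 2 * \<Delta>" using ar2[OF i] by (rule order_trans[rotated]) simp
  have w2: "(\<integral>\<omega>. (w i \<omega>)\<^sup>2 \<partial>M) \<le> \<rho>\<^sup>2 * (2 * S + 2 * \<Delta>)" if "i \<in> {1..n}" for i
  proof -
    have "(\<integral>\<omega>. (w i \<omega>)\<^sup>2 \<partial>M) \<le> (\<Sum>k\<in>{b<..i - 1}. \<bar>\<phi> i k\<bar>)\<^sup>2 * (2 * S + 2 * \<Delta>)"
      unfolding w_def using that by (intro integral_square_sum_le ar ar2) auto
    also have "\<dots> \<le> \<rho>\<^sup>2 * (2 * S + 2 * \<Delta>)"
      using nn by (intro mult_right_mono power_mono \<rho>[OF that] sum_nonneg) auto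
    finally show ?thesis .
  qed
  have "(\<integral>\<omega>. (d i \<omega>)\<^sup>2 \<partial>M) \<le> 2 * \<Lambda>\<^sup>2 * \<rho>\<^sup>2 * S + \<Delta> / 2" if i: "i \<in> {1..n}" for i
  proof -
    have "d i \<omega> = (\<Sum>j = 1..i. innov_coeff i j * w j \<omega>)" for \<omega>
    proof (rule innovation_representation[where d = "\<lambda>i. d i \<omega>" and w = "\<lambda>i. w i \<omega>", OF _ i])
      fix i assume "i \<in> {1..n}"
      then show "w i \<omega> = d i \<omega> - (\<Sum>k = 1..i - 1. \<phi> i k * d (i - k) \<omega>)"
        using ar_process_defect[of i X \<omega> b \<phi>] by (simp add: d_def w_def)
    qed
    then have "(\<integral>\<omega>. (d i \<omega>)\<^sup>2 \<partial>M) = (\<integral>\<omega>. (\<Sum>j\<in>{1..i}. innov_coeff i j * w j \<omega>)\<^sup>2 \<partial>M)" by simp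
    also have "\<dots> \<le> (\<Sum>j\<in>{1..i}. \<bar>innov_coeff i j\<bar>)\<^sup>2 * (\<rho>\<^sup>2 * (2 * S + 2 * \<Delta>))"
      using i by (intro integral_square_sum_le w_sq w2) auto
    also have "\<dots> \<le> \<Lambda>\<^sup>2 * (\<rho>\<^sup>2 * (2 * S + 2 * \<Delta>))"
      unfolding \<Lambda>_def using nn by (intro mult_right_mono power_mono innov_coeff_row_sum A i sum_nonneg) auto
    \<comment> \<open>By \<open>small\<close> the bracketed factor is at most one, which leaves
      \<open>\<Delta> / 2\<close> to absorb.\<close>
    also have "\<dots> = 2 * \<Lambda>\<^sup>2 * \<rho>\<^sup>2 * S + (4 * \<Lambda>\<^sup>2 * \<rho>\<^sup>2) * (\<Delta> / 2)" by (simp add: algebra_simps)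
    also have "\<dots> \<le> 2 * \<Lambda>\<^sup>2 * \<rho>\<^sup>2 * S + 1 * (\<Delta> / 2)"
    proof (intro add_left_mono mult_right_mono)
      have "0 \<le> \<Delta>" by (rule order_trans[OF _ \<Delta>[OF i]]) simp
      then show "0 \<le> \<Delta> / 2" by simp
    qed (use small in \<open>simp add: \<Lambda>_def\<close>)
    finally show ?thesis by simp
  qed
  then have "\<Delta> \<le> 2 * \<Lambda>\<^sup>2 * \<rho>\<^sup>2 * S + \<Delta> / 2"
    unfolding \<Delta>_def using i by (intro Max.boundedI) auto
  then have "\<Delta> \<le> 4 * \<Lambda>\<^sup>2 * \<rho>\<^sup>2 * S" by simp
  with \<Delta>[OF i] show ?thesis by (simp add: d_def \<Lambda>_def)
qed

lemma prediction_kernel_row: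
  fixes X :: "nat \<Rightarrow> 'a \<Rightarrow> real"
  assumes "\<kappa> > 0" "C > 0" "\<tau> > 1"
    and M: "prob_space M" and X: "\<And>i. i \<in> {1..n} \<Longrightarrow> square_integrable M (X i)"
    and \<kappa>: "\<kappa> \<le> smallest_eigenvalue (cov_matrix M n X)"
    and C: "\<And>i j. i \<in> {1..n} \<Longrightarrow> j \<in> {1..n} \<Longrightarrow>
      \<bar>covariance M (X i) (X j)\<bar> \<le> C * (1 + \<bar>real i - real j\<bar>) powr (- \<tau>)"
    and best: "\<And>i. i \<in> {1..n} \<Longrightarrow> best_linear_pred_coeffs M X i (\<phi> i)"
  shows "prediction_kernel \<kappa> C \<tau> n (\<lambda>i j. covariance M (X i) (X j)) \<phi>"
proof
  show "covariance M (X i) (X j) = covariance M (X j) (X i)" for i j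
    by (simp add: covariance_def mult.commute)
  show "\<kappa> * (\<Sum>i\<in>I. (v i)\<^sup>2) \<le> (\<Sum>i\<in>I. \<Sum>j\<in>I. v i * v j * covariance M (X i) (X j))"
    if "I \<subseteq> {1..n}" for I and v :: "nat \<Rightarrow> real"
    by (rule cov_matrix_coercive[OF \<kappa> that])
  fix i l assume i: "i \<in> {1..n}" and l: "1 \<le> l" "l < i"
  \<comment> \<open>The lag \<open>i - l\<close> converts the normal equations from lags to
    times.\<close>
  have "covariance M (X i) (X (i - (i - l)))
      = (\<Sum>j = 1..i - 1. \<phi> i j * covariance M (X (i - j)) (X (i - (i - l))))"
    using i l by (intro best_linear_pred_normal_equations M X best) auto
  then show "covariance M (X i) (X l) = (\<Sum>j = 1..i - 1. \<phi> i j * covariance M (X (i - j)) (X l))"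
    using l by simp
qed (use assms in auto)

theorem theorem2p5:
  fixes M :: "nat \<Rightarrow> 'a measure"
    and x :: "nat \<Rightarrow> nat \<Rightarrow> 'a \<Rightarrow> real"
    and \<phi> :: "nat \<Rightarrow> nat \<Rightarrow> nat \<Rightarrow> real"
    and b :: "nat \<Rightarrow> nat"
    and \<tau> :: real
  assumes "triangular_array M x"
    and "UPDC M x"
    and "\<tau> > 1"
    and "short_range_dependent \<tau> M x"
    and "\<And>n i. 1 \<le> i \<Longrightarrow> i \<le> n \<Longrightarrow> best_linear_pred_coeffs (M n) (x n) i (\<phi> n i)"
    and "\<And>n. 2 \<le> n \<Longrightarrow> 1 \<le> b n \<and> b n < n"
    and "filterlim b at_top sequentially"
  shows "O_l2 {n. 2 \<le> b n} M
           (\<lambda>n i \<omega>. x n i \<omega> - (linear_pred (min (b n) (i - 1)) (\<phi> n i) (x n) i \<omega>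
                              + prediction_error (\<phi> n) (x n) i \<omega>))
           (\<lambda>n. ar_rate \<tau> (b n)) \<and>
         O_l2 {n. 2 \<le> b n} M
           (\<lambda>n i \<omega>. x n i \<omega> - ar_process (b n) (\<phi> n) (x n) i \<omega>)
           (\<lambda>n. ar_rate \<tau> (b n))"
proof -
  have M: "prob_space (M n)" and X: "i \<in> {1..n} \<Longrightarrow> square_integrable (M n) (x n i)" for n i
    using assms(1) by (auto simp: triangular_array_def)
  obtain \<kappa> where \<kappa>: "\<kappa> > 0"
    and ev: "\<forall>\<^sub>F n in sequentially. \<kappa> \<le> smallest_eigenvalue (cov_matrix (M n) n (x n))"
    using assms(2) by (auto simp: UPDC_def)
  obtain C where C: "C > 0" and decay: "\<And>n i j. i \<in> {1..n} \<Longrightarrow> j \<in> {1..n} \<Longrightarrow>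
      \<bar>covariance (M n) (x n i) (x n j)\<bar> \<le> C * (1 + \<bar>real i - real j\<bar>) powr (- \<tau>)"
    using short_range_dependent_kernel[OF assms(3,4)] by blast
  obtain S where S: "S \<ge> 0" and S2: "\<And>n i. i \<in> {1..n} \<Longrightarrow> (\<integral>\<omega>. (x n i \<omega>)\<^sup>2 \<partial>M n) \<le> S"
    using short_range_dependent_second_moment[OF assms(1,4)] by blast
  \<comment> \<open>At least \<open>\<tau> - 3 / 2\<close> to reach the rate and below
    \<open>\<tau> - 1\<close> for the coefficient decay; the second entry keeps it positive when
    \<open>\<tau> \<le> 3 / 2\<close>.\<close>
  define \<beta> where "\<beta> = max (\<tau> - 3 / 2) ((\<tau> - 1) / 2)"
  have \<beta>: "0 < \<beta>" "\<beta> < \<tau> - 1" "\<tau> - 3 / 2 \<le> \<beta>" using \<open>\<tau> > 1\<close> by (auto simp: \<beta>_def max_def)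
  obtain A where A: "A > 0" and l1: "\<And>N a f. decaying_predictor \<kappa> C \<tau> N a f \<Longrightarrow> \<bar>f 0\<bar> = 1 \<Longrightarrow>
      (\<Sum>j\<le>N. \<bar>f j\<bar>) \<le> A \<and> (\<forall>s\<ge>1. (\<Sum>j\<in>{s<..N}. \<bar>f j\<bar>) \<le> A * real s powr (- \<beta>))"
    using decaying_predictor_l1[OF \<kappa> C \<beta>(1,2)] by blast
  define \<Lambda> where "\<Lambda> = C * A / \<kappa> * kernel_sum \<tau>"
  define D where "D = inverse ((ln 2 :: real) powr (\<tau> - 1))"
  have \<Lambda>: "\<Lambda> > 0" using C A \<kappa> kernel_sum_pos[OF assms(3)] by (simp add: \<Lambda>_def)
  have row: "prediction_kernel \<kappa> C \<tau> n (\<lambda>i j. covariance (M n) (x n i) (x n j)) (\<phi> n)"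
    if "\<kappa> \<le> smallest_eigenvalue (cov_matrix (M n) n (x n))" for n
    using that by (intro prediction_kernel_row M X \<kappa> C assms(3,5) decay) auto
  have coeffs: "1 + (\<Sum>j = 1..i - 1. \<bar>\<phi> n i j\<bar>) \<le> A"
      "1 \<le> s \<Longrightarrow> (\<Sum>j\<in>{s<..i - 1}. \<bar>\<phi> n i j\<bar>) \<le> A * real s powr (- \<beta>)"
    if "\<kappa> \<le> smallest_eigenvalue (cov_matrix (M n) n (x n))" and i: "i \<in> {1..n}" for n i s
  proof -
    interpret prediction_kernel \<kappa> C \<tau> n "\<lambda>i j. covariance (M n) (x n i) (x n j)" "\<phi> n"
      using that by (intro row)
    have "\<bar>error_coeff i 0\<bar> = 1" by (simp add: error_coeff_def)
    note bound = l1[OF decaying_predictor[OF i] this]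
    then show "1 + (\<Sum>j = 1..i - 1. \<bar>\<phi> n i j\<bar>) \<le> A" by (simp only: sum_abs_error_coeff)
    assume "1 \<le> s"
    moreover have "(\<Sum>j\<in>{s<..i - 1}. \<bar>\<phi> n i j\<bar>) = (\<Sum>j\<in>{s<..i - 1}. \<bar>error_coeff i j\<bar>)"
      by (intro sum.cong) (auto simp: error_coeff_def)
    ultimately show "(\<Sum>j\<in>{s<..i - 1}. \<bar>\<phi> n i j\<bar>) \<le> A * real s powr (- \<beta>)" using bound by simp
  qed
  have rate: "A * real (b n) powr (- \<beta>) \<le> A * D * ar_rate \<tau> (b n)" if "2 \<le> b n" for n
    using powr_le_ar_rate[OF assms(3) \<beta>(3) that] A by (simp add: D_def mult.assoc)
  \<comment> \<open>As \<open>b\<close> diverges, the coefficient tail beyond \<open>b\<close>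
    vanishes, so the absorption condition of \<open>ar_error_bound\<close> holds eventually.\<close>
  have "(\<lambda>s::nat. real s powr (- \<beta>)) \<longlonglongrightarrow> 0"
    using \<beta>(1) by real_asymp
  then have "(\<lambda>s::nat. 4 * \<Lambda>\<^sup>2 * (A * real s powr (- \<beta>))\<^sup>2) \<longlonglongrightarrow> 4 * \<Lambda>\<^sup>2 * (A * 0)\<^sup>2"
    by (intro tendsto_mult tendsto_power tendsto_const)
  then have "(\<lambda>s::nat. 4 * \<Lambda>\<^sup>2 * (A * real s powr (- \<beta>))\<^sup>2) \<longlonglongrightarrow> 0" by simp
  then have "((\<lambda>n. 4 * \<Lambda>\<^sup>2 * (A * real (b n) powr (- \<beta>))\<^sup>2) \<longlongrightarrow> 0) sequentially"
    by (rule filterlim_compose[OF _ assms(7)])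
  then have small: "\<forall>\<^sub>F n in sequentially. 4 * \<Lambda>\<^sup>2 * (A * real (b n) powr (- \<beta>))\<^sup>2 < 1"
    by (rule order_tendstoD) simp
  show ?thesis
  proof
    show "O_l2 {n. 2 \<le> b n} M
           (\<lambda>n i \<omega>. x n i \<omega> - (linear_pred (min (b n) (i - 1)) (\<phi> n i) (x n) i \<omega>
                              + prediction_error (\<phi> n) (x n) i \<omega>))
           (\<lambda>n. ar_rate \<tau> (b n))"
    \<comment> \<open>\<open>sqrt S\<close> bounds the norms of the entries, and
      \<open>A * D\<close> turns the absolute coefficient tail into the rate.\<close>
    proof (rule O_l2I[where C = "A * D * sqrt S"])
      fix n i assume n: "n \<in> {n. 2 \<le> b n}" and i: "i \<in> {1..n}"
      show "square_integrable (M n) (\<lambda>\<omega>. x n i \<omega> - (linear_pred (min (b n) (i - 1)) (\<phi> n i) (x n) i \<omega>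
                              + prediction_error (\<phi> n) (x n) i \<omega>))"
        using i by (subst truncation_error) (auto intro!: square_integrable_sum square_integrable_cmult X)
    next
      show "\<forall>\<^sub>F n in sequentially. n \<in> {n. 2 \<le> b n} \<longrightarrow> (\<forall>i\<in>{1..n}. sqrt (\<integral>\<omega>.
          (x n i \<omega> - (linear_pred (min (b n) (i - 1)) (\<phi> n i) (x n) i \<omega>
            + prediction_error (\<phi> n) (x n) i \<omega>))\<^sup>2 \<partial>M n) \<le> A * D * sqrt S * ar_rate \<tau> (b n))"
        using ev
      proof eventually_elim
        case (elim n)
        show ?case
        proof (intro impI ballI)
          fix i assume n: "n \<in> {n. 2 \<le> b n}" and i: "i \<in> {1..n}"
          let ?\<rho> = "A * real (b n) powr (- \<beta>)"
          have "(\<integral>\<omega>. (x n i \<omega> - (linear_pred (min (b n) (i - 1)) (\<phi> n i) (x n) i \<omega>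
              + prediction_error (\<phi> n) (x n) i \<omega>))\<^sup>2 \<partial>M n)
              = (\<integral>\<omega>. (\<Sum>j\<in>{b n<..i - 1}. \<phi> n i j * x n (i - j) \<omega>)\<^sup>2 \<partial>M n)"
            using i by (subst truncation_error) auto
          also have "\<dots> \<le> (\<Sum>j\<in>{b n<..i - 1}. \<bar>\<phi> n i j\<bar>)\<^sup>2 * S"
            using i by (intro integral_square_sum_le X S2) auto
          also have "\<dots> \<le> ?\<rho>\<^sup>2 * S"
            using n S by (intro mult_right_mono power_mono coeffs(2)[OF elim i] sum_nonneg) auto
          finally have "sqrt (\<integral>\<omega>. (x n i \<omega> - (linear_pred (min (b n) (i - 1)) (\<phi> n i) (x n) i \<omega>
              + prediction_error (\<phi> n) (x n) i \<omega>))\<^sup>2 \<partial>M n) \<le> sqrt (?\<rho>\<^sup>2 * S)"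
            by (rule real_sqrt_le_mono)
          also have "\<dots> = ?\<rho> * sqrt S" using A by (simp add: real_sqrt_mult)
          also have "\<dots> \<le> A * D * ar_rate \<tau> (b n) * sqrt S"
            using n S by (intro mult_right_mono rate) auto
          finally show "sqrt (\<integral>\<omega>. (x n i \<omega> - (linear_pred (min (b n) (i - 1)) (\<phi> n i) (x n) i \<omega>
              + prediction_error (\<phi> n) (x n) i \<omega>))\<^sup>2 \<partial>M n) \<le> A * D * sqrt S * ar_rate \<tau> (b n)"
            by (simp add: mult_ac)
        qed
      qed
    qed (simp add: ar_rate_pos)
    show "O_l2 {n. 2 \<le> b n} M
           (\<lambda>n i \<omega>. x n i \<omega> - ar_process (b n) (\<phi> n) (x n) i \<omega>)
           (\<lambda>n. ar_rate \<tau> (b n))"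
    \<comment> \<open>\<open>2 * \<Lambda> * sqrt S\<close> is the square root of the factor
      \<open>4 * \<Lambda>\<^sup>2 * S\<close> in \<open>ar_error_bound\<close>.\<close>
    proof (rule O_l2I[where C = "2 * \<Lambda> * sqrt S * (A * D)"])
      fix n i assume n: "n \<in> {n. 2 \<le> b n}" and i: "i \<in> {1..n}"
      show "square_integrable (M n) (\<lambda>\<omega>. x n i \<omega> - ar_process (b n) (\<phi> n) (x n) i \<omega>)"
        by (intro square_integrable_diff square_integrable_ar_process[OF M _ i] X i)
    next
      show "\<forall>\<^sub>F n in sequentially. n \<in> {n. 2 \<le> b n} \<longrightarrow> (\<forall>i\<in>{1..n}. sqrt (\<integral>\<omega>.
          (x n i \<omega> - ar_process (b n) (\<phi> n) (x n) i \<omega>)\<^sup>2 \<partial>M n) \<le> 2 * \<Lambda> * sqrt S * (A * D) * ar_rate \<tau> (b n))"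
        using ev small
      proof eventually_elim
        case (elim n)
        show ?case
        proof (intro impI ballI)
          fix i assume n: "n \<in> {n. 2 \<le> b n}" and i: "i \<in> {1..n}"
          let ?\<rho> = "A * real (b n) powr (- \<beta>)"
          have "(\<integral>\<omega>. (x n i \<omega> - ar_process (b n) (\<phi> n) (x n) i \<omega>)\<^sup>2 \<partial>M n) \<le> 4 * \<Lambda>\<^sup>2 * ?\<rho>\<^sup>2 * S"
            unfolding \<Lambda>_def
          proof (rule ar_error_bound[OF M X S2 row[OF elim(1)] coeffs(1)[OF elim(1)] coeffs(2)[OF elim(1)] _ i])
            show "4 * (C * A / \<kappa> * kernel_sum \<tau>)\<^sup>2 * ?\<rho>\<^sup>2 \<le> 1"
              using elim(2) by (simp add: \<Lambda>_def)
          qed (use n in auto)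
          then have "sqrt (\<integral>\<omega>. (x n i \<omega> - ar_process (b n) (\<phi> n) (x n) i \<omega>)\<^sup>2 \<partial>M n)
              \<le> sqrt ((2 * \<Lambda> * ?\<rho>)\<^sup>2 * S)"
            by (intro real_sqrt_le_mono) (simp add: power_mult_distrib)
          also have "\<dots> = 2 * \<Lambda> * sqrt S * ?\<rho>" using A \<Lambda> by (simp add: real_sqrt_mult)
          also have "\<dots> \<le> 2 * \<Lambda> * sqrt S * (A * D * ar_rate \<tau> (b n))"
            using n S \<Lambda> by (intro mult_left_mono rate) auto
          finally show "sqrt (\<integral>\<omega>. (x n i \<omega> - ar_process (b n) (\<phi> n) (x n) i \<omega>)\<^sup>2 \<partial>M n)
              \<le> 2 * \<Lambda> * sqrt S * (A * D) * ar_rate \<tau> (b n)"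
            by (simp add: mult_ac)
        qed
      qed
    qed (simp add: ar_rate_pos)
  qed
qed

end
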